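(* Let $n\ge 1$. The Hecke ring $\mathcal{H}_n$ of the pair $(S_{2n},B_n)$ is generated as a ring by the elements $$H_i := \sum_{w\in S_{2n},\ c(w)=i} w,\qquad i=1,\ldots,n.$$
   Context: $S_{2n}$ is the symmetric group on $\{1,\dots,2n\}$ and $B_n\subset S_{2n}$ is the hyperoctahedral subgroup, i.e. the centralizer of $t=(1\,2)(3\,4)\cdots(2n-1\,2n)$. Hecke ring: $\mathcal{H}_n=H_{\mathbb Z}(S_{2n},B_n)$ is the $\mathbb Z$-module of functions $f:S_{2n}\to\mathbb Z$ with $f(kgk')=f(g)$ for all $k,k'\in B_n$, $g\in S_{2n}$, with the normalized convolution product $(f*g)(x)=\frac{1}{|B_n|}\sum_{y\in S_{2n}}f(xy^{-1})g(y)$, whose identity is the indicator function of $B_n$. A function $f$ is also written as the formal sum $\sum_{w\in S_{2n}}f(w)\,w$; so $\sum_{c(w)=i}w$ denotes the indicator function of $\{w: c(w)=i\}$. Graph $\varGamma(w)$ for $w\in S_{2n}$: the multigraph with vertex set $\{1,\dots,2n\}$, having for every $k\in\{1,\dots,n\}$ one edge joining the vertices $2k-1$ and $2k$, and one edge joining the vertices $w^{-1}(2k-1)$ and $w^{-1}(2k)$. It is a disjoint union of cycles of even length (a double edge counts as a cycle of length 2). $c(w)$ denotes the number of cycles of $\varGamma(w)$. *)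

theory Defs
  imports "HOL-Algebra.Sym_Groups" "HOL-Algebra.Generated_Rings"
begin

section \<open>The Hecke ring of a pair of finite groups\<close>

(* A function on the group is represented by a total function on the ambient type that
   vanishes outside the carrier, so that equality in the ring is equality of functions. *)

definition hecke_carrier :: "('a, 'b) monoid_scheme \<Rightarrow> 'a set \<Rightarrow> ('a \<Rightarrow> int) set" where
  "hecke_carrier G K =
     {f. (\<forall>g. g \<notin> carrier G \<longrightarrow> f g = 0) \<and>
         (\<forall>g\<in>carrier G. \<forall>k\<in>K. \<forall>k'\<in>K. f (k \<otimes>\<^bsub>G\<^esub> g \<otimes>\<^bsub>G\<^esub> k') = f g)}"

(* The integer division is exact on hecke_carrier G K: see card_dvd_conv below. *)

definition hecke_mult ::
    "('a, 'b) monoid_scheme \<Rightarrow> 'a set \<Rightarrow> ('a \<Rightarrow> int) \<Rightarrow> ('a \<Rightarrow> int) \<Rightarrow> 'a \<Rightarrow> int" where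
  "hecke_mult G K f g =
     (\<lambda>x. if x \<in> carrier G
          then (\<Sum>y\<in>carrier G. f (x \<otimes>\<^bsub>G\<^esub> inv\<^bsub>G\<^esub> y) * g y) div int (card K) else 0)"

definition hecke_ring :: "('a, 'b) monoid_scheme \<Rightarrow> 'a set \<Rightarrow> ('a \<Rightarrow> int) ring" where
  "hecke_ring G K =
     \<lparr>carrier = hecke_carrier G K,
      mult = hecke_mult G K,
      one = (\<lambda>g. if g \<in> K then 1 else 0),
      zero = (\<lambda>g. 0),
      add = (\<lambda>f f' g. f g + f' g)\<rparr>"


section \<open>The hyperoctahedral group\<close>

primrec pair_involution :: "nat \<Rightarrow> nat \<Rightarrow> nat" where
  "pair_involution 0 = id"
| "pair_involution (Suc n) = pair_involution n \<circ> transpose (2 * n + 1) (2 * n + 2)"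

definition hyperoctahedral :: "nat \<Rightarrow> (nat \<Rightarrow> nat) set" where
  "hyperoctahedral n =
     {k \<in> carrier (sym_group (2 * n)). k \<circ> pair_involution n = pair_involution n \<circ> k}"


section \<open>Cycles in multigraphs\<close>

(* Edges have an identity of their own, so parallel edges are allowed. An edge e joins the
   elements of ends e; loopless multigraphs suffice here, so ends e has two elements. *)

record ('v, 'e) multigraph =
  verts :: "'v set"
  edges :: "'e set"
  ends :: "'e \<Rightarrow> 'v set"

(* A cycle, given by its set of edges: a finite nonempty connected subgraph in which every
   vertex has degree 2. *)

definition is_cycle :: "('v, 'e) multigraph \<Rightarrow> 'e set \<Rightarrow> bool" where
  "is_cycle X F \<longleftrightarrow>
     F \<subseteq> edges X \<and> finite F \<and> F \<noteq> {} \<and>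
     (\<forall>v \<in> \<Union>(ends X ` F). card {e \<in> F. v \<in> ends X e} = 2) \<and>
     (\<forall>u \<in> \<Union>(ends X ` F). \<forall>v \<in> \<Union>(ends X ` F).
        (u, v) \<in> {(a, b). \<exists>e\<in>F. ends X e = {a, b}}\<^sup>*)"

(* Inl k is the edge joining 2k-1 and 2k; Inr k the one joining their images under the
   inverse of w. *)

definition Gamma_graph :: "nat \<Rightarrow> (nat \<Rightarrow> nat) \<Rightarrow> (nat, nat + nat) multigraph" where
  "Gamma_graph n w =
     \<lparr>verts = {1..2 * n},
      edges = Inl ` {1..n} \<union> Inr ` {1..n},
      ends = case_sum (\<lambda>k. {2 * k - 1, 2 * k})
                      (\<lambda>k. {inv' w (2 * k - 1), inv' w (2 * k)})\<rparr>"

definition cycle_count :: "nat \<Rightarrow> (nat \<Rightarrow> nat) \<Rightarrow> nat" where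
  "cycle_count n w = card {F. is_cycle (Gamma_graph n w) F}"

definition H_elem :: "nat \<Rightarrow> nat \<Rightarrow> (nat \<Rightarrow> nat) \<Rightarrow> int" where
  "H_elem n i =
     (\<lambda>w. if w \<in> carrier (sym_group (2 * n)) \<and> cycle_count n w = i then 1 else 0)"


section \<open>Well-definedness\<close>

lemma (in group) card_dvd_sum:
  fixes h :: "'a \<Rightarrow> int"
  assumes fin: "finite (carrier G)" and K: "subgroup K G"
    and inv: "\<And>k y. k \<in> K \<Longrightarrow> y \<in> carrier G \<Longrightarrow> h (k \<otimes> y) = h y"
  shows "int (card K) dvd (\<Sum>y\<in>carrier G. h y)"
proof -
  have KG: "K \<subseteq> carrier G" using K by (rule subgroup.subset)
  have "sum h (carrier G) = sum h (\<Union>(rcosets K))"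
    using rcosets_part_G[OF K] by simp
  also have "\<dots> = (\<Sum>C\<in>rcosets K. sum h C)"
    using rcos_disjoint[OF K] rcosets_finite[OF _ KG finite_subset[OF KG fin]]
    by (subst sum.Union_disjoint) (auto simp: pairwise_def disjnt_def)
  also have "int (card K) dvd \<dots>"
  proof (rule dvd_sum)
    fix C assume C: "C \<in> rcosets K"
    then obtain a where a: "a \<in> carrier G" "C = K #> a" unfolding RCOSETS_def by blast
    have "sum h C = (\<Sum>y\<in>C. h a)"
      using a inv by (intro sum.cong) (auto simp: r_coset_def)
    then show "int (card K) dvd sum h C"
      using card_rcosets_equal[OF C KG] by simp
  qed
  finally show ?thesis .
qed

lemma hecke_carrierD:
  assumes "f \<in> hecke_carrier G K"
  shows "g \<notin> carrier G \<Longrightarrow> f g = 0"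
    and "g \<in> carrier G \<Longrightarrow> k \<in> K \<Longrightarrow> k' \<in> K \<Longrightarrow> f (k \<otimes>\<^bsub>G\<^esub> g \<otimes>\<^bsub>G\<^esub> k') = f g"
  using assms by (auto simp: hecke_carrier_def)

locale hecke_pair = group G for G (structure) +
  fixes K
  assumes fin: "finite (carrier G)" and K: "subgroup K G"
begin

lemma K_in_G: "k \<in> K \<Longrightarrow> k \<in> carrier G"
  using K subgroup.mem_carrier by fast

lemma K_closed: "\<one> \<in> K" "k \<in> K \<Longrightarrow> inv k \<in> K" "k \<in> K \<Longrightarrow> k' \<in> K \<Longrightarrow> k \<otimes> k' \<in> K"
  using K by (auto intro: subgroup.one_closed subgroup.m_inv_closed subgroup.m_closed)

lemma inv_cancel:
  assumes "a \<in> carrier G" "b \<in> carrier G"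
  shows "inv a \<otimes> (a \<otimes> b) = b" "a \<otimes> (inv a \<otimes> b) = b"
  using assms by (simp_all flip: m_assoc)

lemma left_inv:
  assumes "f \<in> hecke_carrier G K" "g \<in> carrier G" "k \<in> K"
  shows "f (k \<otimes> g) = f g"
  using hecke_carrierD(2)[OF assms(1,2,3) K_closed(1)] assms K_in_G by simp

lemma right_inv:
  assumes "f \<in> hecke_carrier G K" "g \<in> carrier G" "k \<in> K"
  shows "f (g \<otimes> k) = f g"
  using hecke_carrierD(2)[OF assms(1,2) K_closed(1) assms(3)] assms K_in_G by simp

lemma card_dvd_conv:
  assumes f: "f \<in> hecke_carrier G K" and g: "g \<in> hecke_carrier G K" and x: "x \<in> carrier G"
  shows "int (card K) dvd (\<Sum>y\<in>carrier G. f (x \<otimes> inv y) * g y)"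
proof (rule card_dvd_sum[OF fin K])
  fix k y assume k: "k \<in> K" and y: "y \<in> carrier G"
  have "f (x \<otimes> inv (k \<otimes> y)) = f (x \<otimes> inv y \<otimes> inv k)"
    using x y K_in_G[OF k] by (simp add: inv_mult_group m_assoc)
  also have "\<dots> = f (x \<otimes> inv y)"
    using x y k by (intro right_inv[OF f]) (auto intro: K_closed)
  finally show "f (x \<otimes> inv (k \<otimes> y)) * g (k \<otimes> y) = f (x \<otimes> inv y) * g y"
    using left_inv[OF g y k] by simp
qed

lemma card_K_pos: "int (card K) > 0"
  using K_closed(1) finite_subset[OF subgroup.subset[OF K] fin] by (auto simp: card_gt_0_iff)

lemma card_times_hecke_mult:
  assumes "f \<in> hecke_carrier G K" "g \<in> hecke_carrier G K" "x \<in> carrier G"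
  shows "int (card K) * hecke_mult G K f g x = (\<Sum>y\<in>carrier G. f (x \<otimes> inv y) * g y)"
  using card_dvd_conv[OF assms] assms(3) by (simp add: hecke_mult_def)

lemma hecke_eqI:
  assumes "\<And>x. x \<in> carrier G \<Longrightarrow> int (card K) * f x = int (card K) * g x"
    and "\<And>x. x \<notin> carrier G \<Longrightarrow> f x = g x"
  shows "f = (g :: _ \<Rightarrow> int)"
proof
  fix x show "f x = g x"
    using assms[of x] card_K_pos by (cases "x \<in> carrier G") auto
qed

lemma hecke_mult_closed:
  assumes f: "f \<in> hecke_carrier G K" and g: "g \<in> hecke_carrier G K"
  shows "hecke_mult G K f g \<in> hecke_carrier G K"
proof -
  have "hecke_mult G K f g (k \<otimes> x \<otimes> k') = hecke_mult G K f g x"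
    if x: "x \<in> carrier G" and k: "k \<in> K" and k': "k' \<in> K" for x k k'
  proof -
    note kG = K_in_G[OF k] K_in_G[OF k']
    have "(\<Sum>y\<in>carrier G. f (k \<otimes> x \<otimes> k' \<otimes> inv y) * g y)
        = (\<Sum>y\<in>carrier G. f (k \<otimes> x \<otimes> k' \<otimes> inv (y \<otimes> k')) * g (y \<otimes> k'))"
      using kG by (intro sum.reindex_bij_witness[where i = "\<lambda>y. y \<otimes> k'" and j = "\<lambda>y. y \<otimes> inv k'"])
        (auto simp: m_assoc)
    also have "\<dots> = (\<Sum>y\<in>carrier G. f (x \<otimes> inv y) * g y)"
    proof (rule sum.cong)
      fix y assume y: "y \<in> carrier G"
      have "k \<otimes> x \<otimes> k' \<otimes> inv (y \<otimes> k') = k \<otimes> (x \<otimes> (k' \<otimes> (inv k' \<otimes> inv y)))"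
        using x y kG by (simp add: inv_mult_group m_assoc)
      also have "\<dots> = k \<otimes> (x \<otimes> inv y)"
        using x y kG by (simp add: inv_cancel)
      finally show "f (k \<otimes> x \<otimes> k' \<otimes> inv (y \<otimes> k')) * g (y \<otimes> k') = f (x \<otimes> inv y) * g y"
        using left_inv[OF f _ k] right_inv[OF g y k'] x y by simp
    qed simp
    finally show ?thesis using x kG by (simp add: hecke_mult_def)
  qed
  moreover have "hecke_mult G K f g x = 0" if "x \<notin> carrier G" for x
    using that by (simp add: hecke_mult_def)
  ultimately show ?thesis unfolding hecke_carrier_def by blast
qed

lemma hecke_one_closed: "(\<lambda>g. if g \<in> K then 1 else 0) \<in> hecke_carrier G K"
proof -
  have "k \<otimes> g \<otimes> k' \<in> K \<longleftrightarrow> g \<in> K" if "g \<in> carrier G" "k \<in> K" "k' \<in> K" for g k k'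
  proof
    note kG = K_in_G[OF that(2)] K_in_G[OF that(3)]
    assume "k \<otimes> g \<otimes> k' \<in> K"
    then have "inv k \<otimes> (k \<otimes> g \<otimes> k') \<otimes> inv k' \<in> K"
      by (intro K_closed(3)[OF K_closed(3)[OF K_closed(2)[OF that(2)]] K_closed(2)[OF that(3)]])
    also have "inv k \<otimes> (k \<otimes> g \<otimes> k') \<otimes> inv k' = g"
      using that kG by (simp add: m_assoc inv_cancel)
    finally show "g \<in> K" .
  qed (use that K_closed(3) in simp)
  then show ?thesis using K_in_G by (auto simp: hecke_carrier_def)
qed

lemma hecke_mult_assoc:
  assumes f: "f \<in> hecke_carrier G K" and g: "g \<in> hecke_carrier G K"
    and h: "h \<in> hecke_carrier G K"
  shows "hecke_mult G K (hecke_mult G K f g) h = hecke_mult G K f (hecke_mult G K g h)"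
proof (rule hecke_eqI)
  fix x assume x: "x \<in> carrier G"
  let ?c = "int (card K)"
  have "?c * (?c * hecke_mult G K (hecke_mult G K f g) h x)
      = (\<Sum>y\<in>carrier G. ?c * hecke_mult G K f g (x \<otimes> inv y) * h y)"
    using card_times_hecke_mult[OF hecke_mult_closed[OF f g] h x]
    by (simp add: sum_distrib_left mult.assoc)
  also have "\<dots> = (\<Sum>y\<in>carrier G. \<Sum>z\<in>carrier G. f (x \<otimes> inv y \<otimes> inv z) * g z * h y)"
    using x by (intro sum.cong) (auto simp: card_times_hecke_mult[OF f g] sum_distrib_right)
  also have "\<dots> = (\<Sum>y\<in>carrier G. \<Sum>u\<in>carrier G. f (x \<otimes> inv u) * g (u \<otimes> inv y) * h y)"
  proof (rule sum.cong)
    fix y assume y: "y \<in> carrier G"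
    show "(\<Sum>z\<in>carrier G. f (x \<otimes> inv y \<otimes> inv z) * g z * h y)
        = (\<Sum>u\<in>carrier G. f (x \<otimes> inv u) * g (u \<otimes> inv y) * h y)"
      using x y by (intro sum.reindex_bij_witness[where i = "\<lambda>u. u \<otimes> inv y" and j = "\<lambda>z. z \<otimes> y"])
        (auto simp: m_assoc inv_mult_group)
  qed simp
  also have "\<dots> = (\<Sum>u\<in>carrier G. \<Sum>y\<in>carrier G. f (x \<otimes> inv u) * g (u \<otimes> inv y) * h y)"
    by (rule sum.swap)
  also have "\<dots> = (\<Sum>u\<in>carrier G. f (x \<otimes> inv u) * (?c * hecke_mult G K g h u))"
    by (intro sum.cong) (auto simp: card_times_hecke_mult[OF g h] sum_distrib_left mult.assoc)
  also have "\<dots> = ?c * (?c * hecke_mult G K f (hecke_mult G K g h) x)"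
    using card_times_hecke_mult[OF f hecke_mult_closed[OF g h] x]
    by (simp add: sum_distrib_left mult.left_commute)
  finally show "?c * hecke_mult G K (hecke_mult G K f g) h x
      = ?c * hecke_mult G K f (hecke_mult G K g h) x"
    using card_K_pos by simp
qed (simp add: hecke_mult_def)

lemma hecke_one_left:
  assumes f: "f \<in> hecke_carrier G K"
  shows "hecke_mult G K (\<lambda>g. if g \<in> K then 1 else 0) f = f"
proof (rule hecke_eqI)
  fix x assume x: "x \<in> carrier G"
  have "(\<Sum>y\<in>carrier G. (if x \<otimes> inv y \<in> K then 1 else 0) * f y)
      = (\<Sum>z\<in>carrier G. (if z \<in> K then 1 else 0) * f (inv z \<otimes> x))"
    using x by (intro sum.reindex_bij_witness[where i = "\<lambda>z. inv z \<otimes> x" and j = "\<lambda>y. x \<otimes> inv y"])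
      (auto simp: m_assoc inv_mult_group inv_cancel)
  also have "\<dots> = (\<Sum>z\<in>K. f (inv z \<otimes> x))"
    using fin K_in_G by (intro sum.mono_neutral_cong_right) auto
  also have "\<dots> = (\<Sum>z\<in>K. f x)"
    using left_inv[OF f x] K_closed by (intro sum.cong) auto
  also have "\<dots> = int (card K) * f x" by simp
  finally show "int (card K) * hecke_mult G K (\<lambda>g. if g \<in> K then 1 else 0) f x = int (card K) * f x"
    by (rule trans[OF card_times_hecke_mult[OF hecke_one_closed f x]])
qed (simp add: hecke_mult_def hecke_carrierD(1)[OF f])

lemma hecke_one_right:
  assumes f: "f \<in> hecke_carrier G K"
  shows "hecke_mult G K f (\<lambda>g. if g \<in> K then 1 else 0) = f"
proof (rule hecke_eqI)
  fix x assume x: "x \<in> carrier G"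
  have "(\<Sum>y\<in>carrier G. f (x \<otimes> inv y) * (if y \<in> K then 1 else 0)) = (\<Sum>y\<in>K. f (x \<otimes> inv y))"
    using fin K_in_G by (intro sum.mono_neutral_cong_right) auto
  also have "\<dots> = (\<Sum>z\<in>K. f x)"
    using right_inv[OF f x] K_closed by (intro sum.cong) auto
  also have "\<dots> = int (card K) * f x" by simp
  finally show "int (card K) * hecke_mult G K f (\<lambda>g. if g \<in> K then 1 else 0) x = int (card K) * f x"
    by (rule trans[OF card_times_hecke_mult[OF f hecke_one_closed x]])
qed (simp add: hecke_mult_def hecke_carrierD(1)[OF f])

lemma hecke_add_closed:
  assumes "f \<in> hecke_carrier G K" "g \<in> hecke_carrier G K"
  shows "(\<lambda>x. f x + g x) \<in> hecke_carrier G K"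
  using assms by (auto simp: hecke_carrier_def)

lemma hecke_mult_add_left:
  assumes f: "f \<in> hecke_carrier G K" and g: "g \<in> hecke_carrier G K"
    and h: "h \<in> hecke_carrier G K"
  shows "hecke_mult G K (\<lambda>x. f x + g x) h = (\<lambda>x. hecke_mult G K f h x + hecke_mult G K g h x)"
  by (rule hecke_eqI)
    (simp_all add: card_times_hecke_mult hecke_add_closed f g h distrib_left distrib_right
      sum.distrib, simp_all add: hecke_mult_def)

lemma hecke_mult_add_right:
  assumes f: "f \<in> hecke_carrier G K" and g: "g \<in> hecke_carrier G K"
    and h: "h \<in> hecke_carrier G K"
  shows "hecke_mult G K h (\<lambda>x. f x + g x) = (\<lambda>x. hecke_mult G K h f x + hecke_mult G K h g x)"
  by (rule hecke_eqI)
    (simp_all add: card_times_hecke_mult hecke_add_closed f g h distrib_left distrib_right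
      sum.distrib, simp_all add: hecke_mult_def)

theorem ring_hecke_ring: "ring (hecke_ring G K)"
proof (rule ringI)
  show "abelian_group (hecke_ring G K)"
  proof (rule abelian_groupI)
    fix f assume "f \<in> carrier (hecke_ring G K)"
    then have "(\<lambda>x. - f x) \<in> carrier (hecke_ring G K)"
      by (auto simp: hecke_ring_def hecke_carrier_def)
    then show "\<exists>g\<in>carrier (hecke_ring G K). g \<oplus>\<^bsub>hecke_ring G K\<^esub> f = \<zero>\<^bsub>hecke_ring G K\<^esub>"
      by (rule rev_bexI) (simp add: hecke_ring_def)
  qed (auto simp: hecke_ring_def hecke_carrier_def add_ac)
  show "monoid (hecke_ring G K)"
    by (rule monoidI)
      (auto simp: hecke_ring_def hecke_mult_closed hecke_one_closed hecke_mult_assoc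
        hecke_one_left hecke_one_right)
qed (auto simp: hecke_ring_def hecke_mult_add_left hecke_mult_add_right)

end

lemma pair_involution_permutes: "pair_involution n permutes {1..2 * n}"
proof (induction n)
  case 0
  show ?case by (simp only: pair_involution.simps permutes_id)
next
  case (Suc n)
  have "pair_involution n permutes {1..2 * Suc n}"
    using Suc by (rule permutes_subset) auto
  moreover have "transpose (2 * n + 1) (2 * n + 2) permutes {1..2 * Suc n}"
    by (rule permutes_swap_id) auto
  ultimately show ?case by (simp only: pair_involution.simps permutes_compose)
qed

lemma hyperoctahedral_subgroup: "subgroup (hyperoctahedral n) (sym_group (2 * n))"
proof -
  interpret group "sym_group (2 * n)" by (rule sym_group_is_group)
  show ?thesis
  proof (rule subgroupI)
    show "hyperoctahedral n \<noteq> {}"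
      by (auto simp: hyperoctahedral_def sym_group_carrier intro!: exI[of _ id] permutes_id)
  next
    fix k assume k: "k \<in> hyperoctahedral n"
    then have p: "k permutes {1..2 * n}" and c: "k \<circ> pair_involution n = pair_involution n \<circ> k"
      by (auto simp: hyperoctahedral_def sym_group_carrier)
    have "inv' k \<circ> pair_involution n = inv' k \<circ> (pair_involution n \<circ> k) \<circ> inv' k"
      using permutes_inv_o(1)[OF p] by (simp add: comp_assoc)
    also have "\<dots> = (inv' k \<circ> k) \<circ> pair_involution n \<circ> inv' k"
      by (simp add: c[symmetric] comp_assoc)
    finally have "inv' k \<circ> pair_involution n = pair_involution n \<circ> inv' k"
      using permutes_inv_o(2)[OF p] by simp
    then show "inv\<^bsub>sym_group (2 * n)\<^esub> k \<in> hyperoctahedral n"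
      using p permutes_inv[OF p] by (simp add: hyperoctahedral_def sym_group_carrier)
  next
    fix a b assume "a \<in> hyperoctahedral n" "b \<in> hyperoctahedral n"
    then show "a \<otimes>\<^bsub>sym_group (2 * n)\<^esub> b \<in> hyperoctahedral n"
      by (auto simp: hyperoctahedral_def sym_group_carrier sym_group_mult permutes_compose)
        (metis comp_assoc)
  qed (auto simp: hyperoctahedral_def)
qed

theorem ring_hyperoctahedral_hecke_ring:
  "ring (hecke_ring (sym_group (2 * n)) (hyperoctahedral n))"
proof -
  have "finite (carrier (sym_group (2 * n)))"
    by (simp add: sym_group_def finite_permutations)
  then have "hecke_pair (sym_group (2 * n)) (hyperoctahedral n)"
    by (intro hecke_pair.intro hecke_pair_axioms.intro sym_group_is_group hyperoctahedral_subgroup)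
  then show ?thesis by (rule hecke_pair.ring_hecke_ring)
qed

end

theory Submission
  imports Defs "HOL-Library.Function_Algebras"
begin

text \<open>Left-\<open>B\<^sub>n\<close>-invariant functions on \<open>S\<^sub>2\<^sub>n\<close> are functions on the perfect matchings of
  \<open>{1..2n}\<close>. On them act the commuting Jucys--Murphy operators \<open>J\<^sub>x\<close> (\<open>x\<close> even): right translation
  by the sum of the transpositions \<open>(j x)\<close> with \<open>j < x - 1\<close>. The \<open>r\<close>-th elementary symmetric
  function of the \<open>J\<^sub>x\<close> sends the unit of the Hecke ring to \<open>H\<^sub>n\<^sub>-\<^sub>r\<close>. Right translations commute with
  convolution from the left, so the subring generated by the \<open>H\<^sub>i\<close> is closed under these elementary
  symmetric functions, hence it contains the image \<open>m\<^sub>\<lambda>(J) 1\<close> of the unit under every monomial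
  symmetric function. A product of \<open>d\<close> transpositions applied to the base matching reaches \<open>n - d\<close>
  cycles only if every step merges two cycles, and the largest elements of the cycles then recover
  the monomial. Therefore \<open>m\<^sub>\<lambda>(J) 1\<close> is the indicator function of a single double coset plus terms
  with more cycles, or with as many cycles but fewer nontrivial ones, and unitriangularity over
  the integers yields all indicator functions of double cosets.\<close>

section \<open>Symmetric functions of commuting operators\<close>

text \<open>In general a single \<open>JM x\<close> does not preserve right invariance, so monomials
  in these operators leave the Hecke ring and only symmetric combinations return to it. Biinvariance
  of such a combination is never computed: it follows from membership in the generated subring. Over
  the integers no division is available, so both passages, from elementary to monomial symmetric
  functions and from these to indicators of double cosets, must have leading coefficient 1. The
  transpositions in \<open>JM x\<close> involve only elements of pairs below that of
  \<open>x\<close>. This makes the product of all \<open>1 + JM x\<close>, applied to the unit,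
  reach every matching exactly once, in agreement with the number 1 * 3 * ... * (2n - 1) of
  matchings; sorted by degree it yields the indicators of fixed cycle number. The partition attached
  to a matching is its coset type with every part lowered by one. Its size is then the degree of the
  monomial that reaches the matching, and its number of parts is the number of nontrivial
  cycles.\<close>

lemma image_mset_eq_imp_bij_betw:
  assumes "finite A" "finite B" "image_mset f (mset_set A) = image_mset g (mset_set B)"
  shows "\<exists>h. bij_betw h A B \<and> (\<forall>a\<in>A. g (h a) = f a)"
  using assms
proof (induction A arbitrary: B rule: finite_induct)
  case empty
  then show ?case
    by (auto simp: mset_set_empty_iff bij_betw_def)
next
  case (insert a A)
  have eq: "add_mset (f a) (image_mset f (mset_set A)) = image_mset g (mset_set B)"
    using insert by simp
  then have "f a \<in># image_mset g (mset_set B)"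
    by (metis union_single_eq_member)
  then obtain b where b: "b \<in> B" "g b = f a"
    using insert.prems by auto
  define B' where "B' = B - {b}"
  have B': "B = insert b B'" "b \<notin> B'" "finite B'"
    using b insert.prems by (auto simp: B'_def)
  have "image_mset f (mset_set A) = image_mset g (mset_set B')"
    using eq b B' by simp
  then obtain h where h: "bij_betw h A B'" "\<forall>a\<in>A. g (h a) = f a"
    using insert.IH[OF B'(3)] by blast
  have "bij_betw (h(a := b)) (insert a A) (insert b B')"
    using h(1) insert.hyps B'(2)
    by (metis (no_types, lifting) bij_betw_cong fun_upd_apply fun_upd_same notIn_Un_bij_betw
        Un_insert_right sup_bot_right)
  moreover have "\<forall>a'\<in>insert a A. g ((h(a := b)) a') = f a'"
    using h(2) b insert.hyps by auto
  ultimately show ?case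
    unfolding B'(1) by blast
qed

text \<open>The exponents of a monomial without its variables: a partition of
  \<open>size \<alpha>\<close>. Two multisets have the same type exactly when an injective renaming
  carries one to the other.\<close>

definition mult_type :: "'i multiset \<Rightarrow> nat multiset" where
  "mult_type \<alpha> = image_mset (count \<alpha>) (mset_set (set_mset \<alpha>))"

lemma sum_mset_mult_type: "sum_mset (mult_type \<alpha>) = size \<alpha>"
  by (simp add: mult_type_def size_multiset_overloaded_eq sum_unfold_sum_mset)

lemma size_mult_type: "size (mult_type \<alpha>) = card (set_mset \<alpha>)"
  by (simp add: mult_type_def)

lemma mult_type_eq_size: "mult_type \<alpha> = mult_type \<beta> \<Longrightarrow> size \<alpha> = size \<beta>"
  by (metis sum_mset_mult_type)

lemma mult_type_eq_card: "mult_type \<alpha> = mult_type \<beta> \<Longrightarrow> card (set_mset \<alpha>) = card (set_mset \<beta>)"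
  by (metis size_mult_type)

lemma mult_type_image:
  assumes "inj_on h (set_mset \<alpha>)"
  shows "mult_type (image_mset h \<alpha>) = mult_type \<alpha>"
proof -
  have c: "count (image_mset h \<alpha>) (h x) = count \<alpha> x" if "x \<in># \<alpha>" for x
  proof -
    have "h -` {h x} \<inter> set_mset \<alpha> = {x}"
      using assms that by (auto dest: inj_onD)
    then show ?thesis by (simp add: count_image_mset)
  qed
  have "mult_type (image_mset h \<alpha>) = image_mset (\<lambda>x. count (image_mset h \<alpha>) (h x)) (mset_set (set_mset \<alpha>))"
    using assms by (simp add: mult_type_def image_mset_mset_set[symmetric] multiset.map_comp comp_def)
  also have "\<dots> = mult_type \<alpha>"
    unfolding mult_type_def using c by (intro image_mset_cong) auto
  finally show ?thesis .
qed

lemma mult_type_eq_imp_image: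
  assumes "mult_type \<alpha> = mult_type \<beta>"
  obtains h where "inj_on h (set_mset \<alpha>)" "image_mset h \<alpha> = \<beta>"
proof -
  obtain h where h: "bij_betw h (set_mset \<alpha>) (set_mset \<beta>)" "\<forall>a\<in>set_mset \<alpha>. count \<beta> (h a) = count \<alpha> a"
    using image_mset_eq_imp_bij_betw[of "set_mset \<alpha>" "set_mset \<beta>"] assms
    unfolding mult_type_def by fastforce
  have "count (image_mset h \<alpha>) y = count \<beta> y" for y
  proof (cases "y \<in># \<beta>")
    case True
    then obtain x where x: "x \<in># \<alpha>" "y = h x"
      using h(1) by (auto simp: bij_betw_def)
    then have "h -` {y} \<inter> set_mset \<alpha> = {x}"
      using h(1) by (auto simp: bij_betw_def dest: inj_onD)
    then show ?thesis using h(2) x by (simp add: count_image_mset)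
  next
    case False
    then have "h -` {y} \<inter> set_mset \<alpha> = {}"
      using h(1) by (auto simp: bij_betw_def)
    then show ?thesis using False by (simp add: count_image_mset not_in_iff)
  qed
  then have "image_mset h \<alpha> = \<beta>" by (intro multiset_eqI)
  then show ?thesis using that h(1) by (auto simp: bij_betw_def)
qed

text \<open>The monomial divided by the product of its distinct variables.\<close>

abbreviation strip :: "'i multiset \<Rightarrow> 'i multiset" where
  "strip \<alpha> \<equiv> \<alpha> - mset_set (set_mset \<alpha>)"

text \<open>Truncated subtraction sends the multiplicities of the elements that disappear to \<open>0\<close>;
  padding with these zeros makes the passage to \<^term>\<open>strip \<alpha>\<close> invertible.\<close>

lemma pred_mult_type:
  "image_mset (\<lambda>x. x - 1) (mult_type \<alpha>)
    = mult_type (strip \<alpha>) + replicate_mset (card (set_mset \<alpha>) - card (set_mset (strip \<alpha>))) 0"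
proof -
  let ?A = "set_mset \<alpha>" and ?B = "set_mset (strip \<alpha>)"
  have BA: "?B \<subseteq> ?A" by (auto dest: in_diffD)
  have c: "count (strip \<alpha>) x = count \<alpha> x - 1" if "x \<in># \<alpha>" for x
    using that by simp
  have "image_mset (\<lambda>x. x - 1) (mult_type \<alpha>) = image_mset (count (strip \<alpha>)) (mset_set ?A)"
    unfolding mult_type_def multiset.map_comp using c by (intro image_mset_cong) auto
  also have "\<dots> = image_mset (count (strip \<alpha>)) (mset_set ?B + mset_set (?A - ?B))"
    using BA by (subst mset_set_Union[symmetric]) (auto simp: Un_absorb1)
  also have "\<dots> = mult_type (strip \<alpha>) + image_mset (count (strip \<alpha>)) (mset_set (?A - ?B))"
    by (simp only: mult_type_def image_mset_union)
  also have "image_mset (count (strip \<alpha>)) (mset_set (?A - ?B)) = image_mset (\<lambda>_. 0) (mset_set (?A - ?B))"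
    by (intro image_mset_cong) (simp only: finite_set_mset_mset_set finite_Diff finite_set_mset Diff_iff not_in_iff)
  also have "image_mset (\<lambda>_. 0) (mset_set (?A - ?B)) = replicate_mset (card (?A - ?B)) (0::nat)"
    by (simp add: image_mset_const_eq)
  also have "card (?A - ?B) = card ?A - card ?B"
    using BA by (simp add: card_Diff_subset)
  finally show ?thesis .
qed

text \<open>Lowering all parts of a partition by one and dropping zeros forgets only how many parts
  were equal to 1, and the hypothesis on the number of parts supplies that. Conversely, a renaming
  that carries \<alpha> to \<beta> also carries \<open>strip \<alpha>\<close> to
  \<open>strip \<beta>\<close>.\<close>

lemma mult_type_strip_iff:
  assumes "card (set_mset \<alpha>) = card (set_mset \<beta>)"
  shows "mult_type (strip \<alpha>) = mult_type (strip \<beta>) \<longleftrightarrow> mult_type \<alpha> = mult_type \<beta>"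
proof
  have Suc_pred: "image_mset Suc (image_mset (\<lambda>x. x - 1) (mult_type \<gamma>)) = mult_type \<gamma>" for \<gamma> :: "'c multiset"
    unfolding mult_type_def multiset.map_comp by (intro image_mset_cong) auto
  assume eq: "mult_type (strip \<alpha>) = mult_type (strip \<beta>)"
  from mult_type_eq_card[OF this] eq assms
  have "image_mset (\<lambda>x. x - 1) (mult_type \<alpha>) = image_mset (\<lambda>x. x - 1) (mult_type \<beta>)"
    unfolding pred_mult_type by simp
  then show "mult_type \<alpha> = mult_type \<beta>" by (metis Suc_pred)
next
  assume eq: "mult_type \<alpha> = mult_type \<beta>"
  then obtain h where h: "inj_on h (set_mset \<alpha>)" "image_mset h \<alpha> = \<beta>"
    by (rule mult_type_eq_imp_image)
  have "mset_set (set_mset \<alpha>) \<subseteq># \<alpha>" by (rule mset_set_set_mset_msubset)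
  then have "image_mset h (strip \<alpha>) = image_mset h \<alpha> - image_mset h (mset_set (set_mset \<alpha>))"
    by (rule image_mset_Diff)
  also have "image_mset h (mset_set (set_mset \<alpha>)) = mset_set (set_mset \<beta>)"
    using h by (auto simp: image_mset_mset_set)
  finally have "image_mset h (strip \<alpha>) = strip \<beta>" using h by simp
  moreover have "inj_on h (set_mset (strip \<alpha>))"
    by (rule inj_on_subset[OF h(1)]) (auto dest: in_diffD)
  ultimately show "mult_type (strip \<alpha>) = mult_type (strip \<beta>)"
    by (metis mult_type_image)
qed

text \<open>Index set of the monomial symmetric function of the partition \<pi> in the variables
  \<open>I\<close>.\<close>

definition typed_multisets :: "'i set \<Rightarrow> nat multiset \<Rightarrow> 'i multiset set" where
  "typed_multisets I \<pi> = {\<alpha>. set_mset \<alpha> \<subseteq> I \<and> mult_type \<alpha> = \<pi>}"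

lemma finite_typed_multisets: "finite I \<Longrightarrow> finite (typed_multisets I \<pi>)"
  by (rule finite_subset[OF _ finite_multisets_of_size[of I "sum_mset \<pi>"]])
    (auto simp: typed_multisets_def multisets_of_size_def sum_mset_mult_type)

section \<open>Symmetric polynomials evaluated at commuting additive operators\<close>

locale commuting_operators =
  fixes I :: "'i set" and T :: "'i \<Rightarrow> 'v::ab_group_add \<Rightarrow> 'v"
  assumes fin: "finite I"
    and add: "T i (u + v) = T i u + T i v"
    and comm: "T i (T j v) = T j (T i v)"
begin

definition mon :: "'i multiset \<Rightarrow> 'v \<Rightarrow> 'v" where
  "mon \<alpha> v = fold_mset T v \<alpha>"

definition esym :: "'i set \<Rightarrow> nat \<Rightarrow> 'v \<Rightarrow> 'v" where
  "esym S r v = (\<Sum>A | A \<subseteq> S \<and> card A = r. mon (mset_set A) v)"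

definition msym :: "nat multiset \<Rightarrow> 'v \<Rightarrow> 'v" where
  "msym \<pi> v = (\<Sum>\<alpha>\<in>typed_multisets I \<pi>. mon \<alpha> v)"

sublocale comp_fun_commute T
  by standard (auto simp: comm)

lemma mon_empty [simp]: "mon {#} v = v"
  by (simp add: mon_def)

lemma mon_add_mset [simp]: "mon (add_mset i \<alpha>) v = T i (mon \<alpha> v)"
  by (simp add: mon_def)

lemma mon_union: "mon (\<alpha> + \<beta>) v = mon \<alpha> (mon \<beta> v)"
  by (induction \<alpha>) auto

lemma mon_add: "mon \<alpha> (u + v) = mon \<alpha> u + mon \<alpha> v"
  by (induction \<alpha>) (auto simp: add)

lemma mon_0: "mon \<alpha> 0 = 0"
  using mon_add[of \<alpha> 0 0] by simp

lemma mon_sum: "mon \<alpha> (\<Sum>x\<in>X. f x) = (\<Sum>x\<in>X. mon \<alpha> (f x))"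
  by (induction X rule: infinite_finite_induct) (auto simp: mon_0 mon_add)

lemma esym_0: "finite S \<Longrightarrow> esym S 0 v = v"
proof -
  assume "finite S"
  then have "{A. A \<subseteq> S \<and> card A = 0} = {{}}"
    using finite_subset by fastforce
  then show ?thesis by (simp add: esym_def)
qed

text \<open>Subsets are split by whether they contain \<open>b\<close>. The evaluation of e_r at the
  unit of the Hecke ring removes one index at a time by this recurrence.\<close>

lemma esym_insert:
  assumes "finite S" "b \<notin> S"
  shows "esym (insert b S) (Suc r) v = esym S (Suc r) v + T b (esym S r v)"
proof -
  let ?X = "\<lambda>r. {A. A \<subseteq> S \<and> card A = r}"
  have fin_A: "finite A" if "A \<subseteq> S" for A
    using that assms(1) by (rule finite_subset)
  have fin_X: "finite (?X r)" for r using assms(1) by simp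
  have "{A. A \<subseteq> insert b S \<and> card A = Suc r} = ?X (Suc r) \<union> insert b ` ?X r"
  proof (intro equalityI subsetI)
    fix A assume A: "A \<in> {A. A \<subseteq> insert b S \<and> card A = Suc r}"
    show "A \<in> ?X (Suc r) \<union> insert b ` ?X r"
    proof (cases "b \<in> A")
      case True
      then have "A = insert b (A - {b})" by blast
      moreover have "A - {b} \<in> ?X r" using A True by auto
      ultimately show ?thesis by blast
    qed (use A in auto)
  next
    fix A assume "A \<in> ?X (Suc r) \<union> insert b ` ?X r"
    then show "A \<in> {A. A \<subseteq> insert b S \<and> card A = Suc r}"
    proof
      assume "A \<in> insert b ` ?X r"
      then obtain B where B: "A = insert b B" "B \<subseteq> S" "card B = r" by auto
      then have "b \<notin> B" using assms(2) by blast
      then show ?thesis using B fin_A[OF B(2)] by auto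
    qed auto
  qed
  moreover have "?X (Suc r) \<inter> insert b ` ?X r = {}" using assms(2) by auto
  ultimately have "esym (insert b S) (Suc r) v
      = esym S (Suc r) v + (\<Sum>A\<in>insert b ` ?X r. mon (mset_set A) v)"
    unfolding esym_def using fin_X by (simp add: sum.union_disjoint)
  also have "(\<Sum>A\<in>insert b ` ?X r. mon (mset_set A) v) = (\<Sum>A\<in>?X r. mon (mset_set (insert b A)) v)"
    using assms(2) by (intro sum.reindex_cong[of "insert b"]) (auto simp: inj_on_def insert_ident)
  also have "\<dots> = (\<Sum>A\<in>?X r. mon {#b#} (mon (mset_set A) v))"
  proof (rule sum.cong)
    fix A assume "A \<in> ?X r"
    then have "finite A" "b \<notin> A" using fin_A assms(2) by auto
    then show "mon (mset_set (insert b A)) v = mon {#b#} (mon (mset_set A) v)" by simp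
  qed simp
  also have "\<dots> = T b (esym S r v)"
    unfolding mon_sum[symmetric] esym_def by simp
  finally show ?thesis .
qed

end

text \<open>\<open>V\<close> plays the part of the subring generated by the \<open>H_elem\<close>.
  Only its additive group and its stability under e_r are kept; e_r stands for right multiplication
  by \<open>H_elem n (n - r)\<close>, and the bound on \<open>r\<close> keeps that subtraction
  exact.\<close>

locale esym_closed = commuting_operators +
  fixes V :: "'b set" and v\<^sub>0 :: 'b
  assumes v0: "v\<^sub>0 \<in> V"
    and V_add: "u \<in> V \<Longrightarrow> v \<in> V \<Longrightarrow> u + v \<in> V"
    and V_uminus: "u \<in> V \<Longrightarrow> - u \<in> V"
    and V_esym: "r \<le> card I \<Longrightarrow> u \<in> V \<Longrightarrow> esym I r u \<in> V"
begin

lemma V_0: "0 \<in> V"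
  using V_add[OF v0 V_uminus[OF v0]] by simp

lemma V_sum: "(\<And>x. x \<in> X \<Longrightarrow> f x \<in> V) \<Longrightarrow> sum f X \<in> V"
  by (induction X rule: infinite_finite_induct) (auto simp: V_0 V_add)

text \<open>\<open>Z\<close> lists the terms of an expanded polynomial with repetition. If all
  monomials of one type occur equally often, the polynomial is symmetric, hence an integer
  combination of the monomial symmetric functions of the types that occur.\<close>

lemma sum_mon_in_V:
  assumes "finite Z"
    and sub: "\<And>z. z \<in> Z \<Longrightarrow> set_mset (g z) \<subseteq> I"
    and msym: "\<And>z. z \<in> Z \<Longrightarrow> msym (mult_type (g z)) v\<^sub>0 \<in> V"
    and card: "\<And>\<alpha> \<beta>. set_mset \<alpha> \<subseteq> I \<Longrightarrow> set_mset \<beta> \<subseteq> I \<Longrightarrow> mult_type \<alpha> = mult_type \<beta> \<Longrightarrow>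
                 card {z \<in> Z. g z = \<alpha>} = card {z \<in> Z. g z = \<beta>}"
  shows "(\<Sum>z\<in>Z. mon (g z) v\<^sub>0) \<in> V"
proof -
  have "(\<Sum>z\<in>Z. mon (g z) v\<^sub>0)
      = (\<Sum>\<pi>\<in>(mult_type \<circ> g) ` Z. \<Sum>z | z \<in> Z \<and> (mult_type \<circ> g) z = \<pi>. mon (g z) v\<^sub>0)"
    using assms(1) by (rule sum.image_gen)
  also have "\<dots> \<in> V"
  proof (rule V_sum)
    fix \<pi> assume "\<pi> \<in> (mult_type \<circ> g) ` Z"
    then obtain z0 where z0: "z0 \<in> Z" "\<pi> = mult_type (g z0)" by auto
    let ?Z = "{z \<in> Z. (mult_type \<circ> g) z = \<pi>}" and ?S = "typed_multisets I \<pi>"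
    \<comment> \<open>In a bare abelian group the multiple by the common multiplicity is written as
      a sum of \<open>?N\<close> equal terms.\<close>
    let ?N = "card {z \<in> Z. g z = g z0}"
    have "(\<Sum>z\<in>?Z. mon (g z) v\<^sub>0) = (\<Sum>\<alpha>\<in>?S. \<Sum>z | z \<in> ?Z \<and> g z = \<alpha>. mon (g z) v\<^sub>0)"
      using assms(1) sub by (intro sum.group[symmetric] finite_typed_multisets fin)
        (auto simp: typed_multisets_def)
    also have "\<dots> = (\<Sum>\<alpha>\<in>?S. \<Sum>i<?N. mon \<alpha> v\<^sub>0)"
    proof (rule sum.cong)
      fix \<alpha> assume \<alpha>: "\<alpha> \<in> ?S"
      let ?F = "{z \<in> ?Z. g z = \<alpha>}"
      have F: "?F = {z \<in> Z. g z = \<alpha>}"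
        using \<alpha> by (auto simp: typed_multisets_def)
      have "card ?F = ?N"
        unfolding F using \<alpha> z0 sub by (intro card) (auto simp: typed_multisets_def)
      then obtain h where h: "bij_betw h {..<?N} ?F"
        using finite_same_card_bij[of "{..<?N}" ?F] assms(1) by auto
      have "(\<Sum>z\<in>?F. mon (g z) v\<^sub>0) = (\<Sum>z\<in>?F. mon \<alpha> v\<^sub>0)"
        by (intro sum.cong) auto
      also have "\<dots> = (\<Sum>i<?N. mon \<alpha> v\<^sub>0)"
        using sum.reindex_bij_betw[OF h, of "\<lambda>_. mon \<alpha> v\<^sub>0"] by simp
      finally show "(\<Sum>z\<in>?F. mon (g z) v\<^sub>0) = (\<Sum>i<?N. mon \<alpha> v\<^sub>0)" .
    qed simp
    also have "\<dots> = (\<Sum>i<?N. msym \<pi> v\<^sub>0)"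
      unfolding msym_def by (rule sum.swap)
    also have "\<dots> \<in> V"
      using msym[OF z0(1)] z0(2) by (intro V_sum) auto
    finally show "(\<Sum>z\<in>?Z. mon (g z) v\<^sub>0) \<in> V" .
  qed
  finally show ?thesis .
qed

text \<open>If \<open>\<alpha>\<close> has \<open>r\<close> distinct elements, then \<open>e\<^sub>r\<close> times the monomial symmetric function of
  \<^term>\<open>strip \<alpha>\<close> is that of \<open>\<alpha>\<close> plus a combination of those of multisets with more than \<open>r\<close>
  distinct elements.\<close>

theorem msym_in_V:
  assumes "set_mset \<alpha> \<subseteq> I"
  shows "msym (mult_type \<alpha>) v\<^sub>0 \<in> V"
  using assms
\<comment> \<open>Two kinds of earlier multisets occur: \<open>strip \<alpha>\<close> has smaller
  size, and the error terms have the same size but more distinct elements. Since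
  \<open>card I\<close> bounds the number of distinct elements, its growth counts as
  descent.\<close>
proof (induction \<alpha> rule: wf_induct[OF wf_measures[of "[size, \<lambda>\<alpha>. card I - card (set_mset \<alpha>)]"]])
  case (1 \<alpha>)
  have IH: "msym (mult_type \<beta>) v\<^sub>0 \<in> V"
    if "size \<beta> < size \<alpha> \<or> size \<beta> = size \<alpha> \<and> card I - card (set_mset \<beta>) < card I - card (set_mset \<alpha>)"
      and "set_mset \<beta> \<subseteq> I" for \<beta>
    using "1.IH" that by (simp, blast)
  show ?case
  proof (cases "\<alpha> = {#}")
    case True
    then have "typed_multisets I (mult_type \<alpha>) = {{#}}"
      by (auto simp: typed_multisets_def dest: mult_type_eq_size)
    then show ?thesis using v0 by (simp add: msym_def)
  next
    case False
    define r where "r = card (set_mset \<alpha>)"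
    define \<kappa> where "\<kappa> = mult_type (strip \<alpha>)"
    have msub: "mset_set (set_mset \<gamma>) \<subseteq># \<gamma>" for \<gamma> :: "'a multiset"
      by (rule mset_set_set_mset_msubset)
    have rI: "r \<le> card I"
      unfolding r_def using "1.prems" fin by (rule card_mono[rotated])
    have r0: "r > 0" using False by (simp add: r_def card_gt_0_iff)
    have size_strip: "size (strip \<gamma>) + card (set_mset \<gamma>) = size \<gamma>" for \<gamma> :: "'a multiset"
      using size_Diff_submset[OF msub[of \<gamma>]] size_mset_mono[OF msub[of \<gamma>]] by simp
    have "set_mset (strip \<alpha>) \<subseteq> I" using "1.prems" by (auto dest: in_diffD)
    moreover have "size (strip \<alpha>) < size \<alpha>"
      using size_strip[of \<alpha>] r0 by (simp add: r_def)
    ultimately have "msym \<kappa> v\<^sub>0 \<in> V"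
      unfolding \<kappa>_def by (intro IH) auto
    then have inV: "esym I r (msym \<kappa> v\<^sub>0) \<in> V" by (rule V_esym[OF rI])
    \<comment> \<open>The terms of the expanded product of e_r with the monomial symmetric function
      of \<kappa>.\<close>
    define P where "P = {A. A \<subseteq> I \<and> card A = r} \<times> typed_multisets I \<kappa>"
    define g where "g = (\<lambda>(A, \<beta>). mset_set A + \<beta> :: 'a multiset)"
    have finP: "finite P"
      unfolding P_def using fin by (intro finite_cartesian_product finite_typed_multisets) auto
    have finA: "finite A" if "(A, \<beta>) \<in> P" for A \<beta>
      using that finite_subset[OF _ fin] by (auto simp: P_def)
    have E: "esym I r (msym \<kappa> v\<^sub>0) = (\<Sum>z\<in>P. mon (g z) v\<^sub>0)"
      by (simp add: esym_def msym_def P_def g_def mon_sum sum.cartesian_product mon_union case_prod_unfold)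
    have gI: "set_mset (g z) \<subseteq> I" if "z \<in> P" for z
    proof -
      obtain A \<beta> where z: "z = (A, \<beta>)" by fastforce
      then have "finite A" using that finA by blast
      then show ?thesis using that z by (auto simp: P_def g_def typed_multisets_def)
    qed
    have gsize: "size (g z) = size \<alpha>" if "z \<in> P" for z
    proof -
      obtain A \<beta> where z: "z = (A, \<beta>)" by fastforce
      have "size \<beta> = size (strip \<alpha>)"
        using that z by (auto simp: P_def typed_multisets_def \<kappa>_def intro: mult_type_eq_size)
      then show ?thesis using that z size_strip[of \<alpha>] by (auto simp: P_def g_def r_def)
    qed
    have supp_le: "r \<le> card (set_mset (g z))" if "z \<in> P" for z
    proof -
      obtain A \<beta> where z: "z = (A, \<beta>)" by fastforce
      then have "finite A" using that finA by blast
      then have "A \<subseteq> set_mset (g z)" "card A = r"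
        using that z by (auto simp: g_def P_def)
      then show ?thesis by (metis card_mono finite_set_mset)
    qed
    \<comment> \<open>If a product has only r distinct elements, these are exactly \<open>A\<close>,
      so both factors can be read off from it. Each multiset of the type of \<alpha> therefore
      occurs exactly once, which is the leading coefficient 1.\<close>
    define P0 where "P0 = {z \<in> P. card (set_mset (g z)) = r}"
    define P1 where "P1 = {z \<in> P. card (set_mset (g z)) \<noteq> r}"
    have "P = P0 \<union> P1" "P0 \<inter> P1 = {}" by (auto simp: P0_def P1_def)
    then have split: "(\<Sum>z\<in>P. mon (g z) v\<^sub>0) = (\<Sum>z\<in>P0. mon (g z) v\<^sub>0) + (\<Sum>z\<in>P1. mon (g z) v\<^sub>0)"
      using finP by (metis finite_Un sum.union_disjoint)
    have "(\<Sum>z\<in>P0. mon (g z) v\<^sub>0) = msym (mult_type \<alpha>) v\<^sub>0"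
      unfolding msym_def
    proof (rule sum.reindex_bij_witness[where j = g and i = "\<lambda>\<gamma>. (set_mset \<gamma>, strip \<gamma>)"])
      fix z assume z: "z \<in> P0"
      obtain A \<beta> where Ab: "z = (A, \<beta>)" by fastforce
      have "finite A" using z Ab finA P0_def by blast
      then have "A \<subseteq> set_mset (g z)" "card A = card (set_mset (g z))"
        using z Ab by (auto simp: g_def P_def P0_def)
      then have A: "A = set_mset (g z)" by (metis card_subset_eq finite_set_mset)
      then have \<beta>: "\<beta> = strip (g z)" using Ab by (simp add: g_def)
      show "(set_mset (g z), strip (g z)) = z" using A \<beta> Ab by metis
      have "mult_type \<beta> = mult_type (strip \<alpha>)"
        using z Ab by (auto simp: P0_def P_def typed_multisets_def \<kappa>_def)
      then have "mult_type (strip (g z)) = mult_type (strip \<alpha>)"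
        using \<beta> by metis
      then have "mult_type (g z) = mult_type \<alpha>"
        using z by (subst mult_type_strip_iff[symmetric]) (auto simp: P0_def r_def)
      then show "g z \<in> typed_multisets I (mult_type \<alpha>)"
        using gI z by (auto simp: typed_multisets_def P0_def)
    next
      fix \<gamma> assume \<gamma>: "\<gamma> \<in> typed_multisets I (mult_type \<alpha>)"
      then have I: "set_mset \<gamma> \<subseteq> I" and eq: "mult_type \<gamma> = mult_type \<alpha>"
        by (auto simp: typed_multisets_def)
      show g: "g (set_mset \<gamma>, strip \<gamma>) = \<gamma>"
        using msub[of \<gamma>] by (simp add: g_def)
      have "mult_type (strip \<gamma>) = \<kappa>"
        using mult_type_strip_iff[OF mult_type_eq_card[OF eq]] eq by (simp add: \<kappa>_def)
      then show "(set_mset \<gamma>, strip \<gamma>) \<in> P0"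
        using I mult_type_eq_card[OF eq] g
        by (auto simp: P0_def P_def r_def typed_multisets_def dest: in_diffD)
    qed auto
    moreover have "(\<Sum>z\<in>P1. mon (g z) v\<^sub>0) \<in> V"
    proof (rule sum_mon_in_V)
      show "finite P1" using finP by (simp add: P1_def)
      fix z assume "z \<in> P1"
      then have z: "z \<in> P" "card (set_mset (g z)) \<noteq> r" by (auto simp: P1_def)
      show zI: "set_mset (g z) \<subseteq> I" by (rule gI[OF z(1)])
      have "card (set_mset (g z)) \<le> card I" using zI fin by (rule card_mono[rotated])
      with supp_le[OF z(1)] z(2) have "card I - card (set_mset (g z)) < card I - card (set_mset \<alpha>)"
        unfolding r_def by linarith
      then show "msym (mult_type (g z)) v\<^sub>0 \<in> V"
        using zI gsize[OF z(1)] by (intro IH) auto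
    next
      fix \<gamma> \<delta> :: "'a multiset"
      assume I: "set_mset \<gamma> \<subseteq> I" "set_mset \<delta> \<subseteq> I" and eq: "mult_type \<gamma> = mult_type \<delta>"
      \<comment> \<open>An injective renaming of variables carries the terms with product \<gamma>
        to terms with product \<delta>. This gives only an inequality, but the roles of \<gamma> and
        \<delta> can be exchanged.\<close>
      have le: "card {z \<in> P1. g z = \<gamma>} \<le> card {z \<in> P1. g z = \<delta>}"
        if I: "set_mset \<delta> \<subseteq> I" and eq: "mult_type \<gamma> = mult_type \<delta>" for \<gamma> \<delta>
      proof -
        obtain h where h: "inj_on h (set_mset \<gamma>)" "image_mset h \<gamma> = \<delta>"
          using eq by (rule mult_type_eq_imp_image)
        have "inj_on (\<lambda>(A, \<beta>). (h ` A, image_mset h \<beta>)) {z \<in> P1. g z = \<gamma>}"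
        proof (rule inj_onI)
          fix z z' assume z: "z \<in> {z \<in> P1. g z = \<gamma>}" and z': "z' \<in> {z \<in> P1. g z = \<gamma>}"
            and eq: "(\<lambda>(A, \<beta>). (h ` A, image_mset h \<beta>)) z = (\<lambda>(A, \<beta>). (h ` A, image_mset h \<beta>)) z'"
          obtain A \<beta> A' \<beta>' where zz: "z = (A, \<beta>)" "z' = (A', \<beta>')" by fastforce
          have f: "mset_set A + \<beta> = \<gamma>" "mset_set A' + \<beta>' = \<gamma>"
            using z z' zz by (auto simp: g_def)
          have "finite A" "finite A'" using z z' zz finA unfolding P1_def by blast+
          then have "A \<subseteq> set_mset \<gamma>" "A' \<subseteq> set_mset \<gamma>"
            using f by (metis UnCI finite_set_mset_mset_set set_mset_union subsetI)+
          moreover have "h ` A = h ` A'" using eq zz by simp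
          ultimately have "A = A'" using h(1) by (simp add: inj_on_image_eq_iff)
          then show "z = z'" using f zz by (metis add_left_cancel)
        qed
        moreover have "(\<lambda>(A, \<beta>). (h ` A, image_mset h \<beta>)) ` {z \<in> P1. g z = \<gamma>} \<subseteq> {z \<in> P1. g z = \<delta>}"
        proof clarify
          fix A \<beta> assume z: "(A, \<beta>) \<in> P1" and g: "\<gamma> = g (A, \<beta>)"
          have A: "finite A" using z finA unfolding P1_def by blast
          have sub: "A \<subseteq> set_mset \<gamma>" "set_mset \<beta> \<subseteq> set_mset \<gamma>"
            using g A by (auto simp: g_def)
          have inj: "inj_on h A" "inj_on h (set_mset \<beta>)"
            using sub h(1) by (auto intro: inj_on_subset)
          have gd: "g (h ` A, image_mset h \<beta>) = \<delta>"
            using h(2) g inj by (auto simp: g_def image_mset_mset_set)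
          have "card (set_mset \<gamma>) = card (set_mset \<delta>)"
            using eq by (rule mult_type_eq_card)
          moreover have "h ` set_mset \<gamma> = set_mset \<delta>" using h(2) by auto
          ultimately show "(h ` A, image_mset h \<beta>) \<in> P1 \<and> g (h ` A, image_mset h \<beta>) = \<delta>"
            using z sub I gd g inj
            by (auto simp: P1_def P_def typed_multisets_def card_image mult_type_image)
        qed
        ultimately show ?thesis
          using finP by (intro card_inj_on_le) (auto simp: P1_def)
      qed
      show "card {z \<in> P1. g z = \<gamma>} = card {z \<in> P1. g z = \<delta>}"
        using le[OF I(2) eq] le[OF I(1) eq[symmetric]] by simp
    qed
    ultimately have "msym (mult_type \<alpha>) v\<^sub>0 = esym I r (msym \<kappa> v\<^sub>0) + - (\<Sum>z\<in>P1. mon (g z) v\<^sub>0)"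
      using E split by simp
    then show ?thesis
      using inV \<open>(\<Sum>z\<in>P1. mon (g z) v\<^sub>0) \<in> V\<close> by (metis V_add V_uminus)
  qed
qed

end

section \<open>Components of the union of two matchings\<close>

definition components :: "'a set \<Rightarrow> ('a \<times> 'a) set \<Rightarrow> 'a set set" where
  "components A E = (\<lambda>a. E\<^sup>* `` {a}) ` A"

lemma Image_rtrancl_eq_iff:
  assumes "sym E"
  shows "E\<^sup>* `` {a} = E\<^sup>* `` {b} \<longleftrightarrow> (a, b) \<in> E\<^sup>*"
  using sym_rtrancl[OF assms] by (auto dest: symD intro: rtrancl_trans)

lemma components_coarser:
  assumes "E \<subseteq> E'\<^sup>*"
  shows "components A E' = (\<lambda>D. E'\<^sup>* `` D) ` components A E"
proof -
  have "E\<^sup>* \<subseteq> E'\<^sup>*" using rtrancl_mono[OF assms] by simp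
  then have "E'\<^sup>* `` (E\<^sup>* `` {a}) = E'\<^sup>* `` {a}" for a
    by (auto intro: rtrancl_trans)
  then show ?thesis by (simp add: components_def image_image)
qed

lemma card_components_coarser:
  assumes "finite A" "E \<subseteq> E'\<^sup>*"
  shows "card (components A E') \<le> card (components A E)"
  using assms unfolding components_coarser[OF assms(2)]
  by (intro card_image_le) (simp add: components_def)

text \<open>Coarsening maps the classes of \<open>E\<close> onto those of \<open>E'\<close>. With
  equal finite numbers of classes this map is injective, so no two classes were merged.\<close>

lemma components_coarser_same_card:
  assumes "finite A" "sym E" "E \<subseteq> E'\<^sup>*" "card (components A E') = card (components A E)"
    and "a \<in> A" "b \<in> A" "(a, b) \<in> E'\<^sup>*"
    and "sym E'"
  shows "(a, b) \<in> E\<^sup>*"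
proof -
  have fin: "finite (components A E)" using assms(1) by (simp add: components_def)
  have inj: "inj_on (\<lambda>D. E'\<^sup>* `` D) (components A E)"
    using assms(4) unfolding components_coarser[OF assms(3)] by (rule eq_card_imp_inj_on[OF fin])
  have "E\<^sup>* \<subseteq> E'\<^sup>*" using rtrancl_mono[OF assms(3)] by simp
  then have img: "E'\<^sup>* `` (E\<^sup>* `` {c}) = E'\<^sup>* `` {c}" for c
    by (auto intro: rtrancl_trans)
  have "E'\<^sup>* `` (E\<^sup>* `` {a}) = E'\<^sup>* `` (E\<^sup>* `` {b})"
    unfolding img Image_rtrancl_eq_iff[OF assms(8)] by (rule assms(7))
  then have "E\<^sup>* `` {a} = E\<^sup>* `` {b}"
    by (rule inj_onD[OF inj]) (use assms(5,6) in \<open>auto simp: components_def\<close>)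
  then show ?thesis using Image_rtrancl_eq_iff[OF assms(2)] by simp
qed

definition add_link :: "'a \<Rightarrow> 'a \<Rightarrow> ('a \<times> 'a) set \<Rightarrow> ('a \<times> 'a) set" where
  "add_link j x E = insert (j, x) (insert (x, j) E)"

lemma sym_add_link: "sym E \<Longrightarrow> sym (add_link j x E)"
  by (auto simp: add_link_def sym_def)

lemma subset_add_link: "E \<subseteq> (add_link j x E)\<^sup>*"
  by (auto simp: add_link_def)

lemma add_link_connected:
  assumes "sym E" "(j, x) \<in> E\<^sup>*"
  shows "(add_link j x E)\<^sup>* = E\<^sup>*"
proof
  have "(x, j) \<in> E\<^sup>*" using assms sym_rtrancl[OF assms(1)] by (auto dest: symD)
  then have "add_link j x E \<subseteq> E\<^sup>*" using assms(2) by (auto simp: add_link_def)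
  then show "(add_link j x E)\<^sup>* \<subseteq> E\<^sup>*" by (rule rtrancl_subset_rtrancl)
qed (auto intro!: rtrancl_mono simp: add_link_def)

lemma Image_add_link:
  assumes "sym E"
  defines "C \<equiv> \<lambda>a. E\<^sup>* `` {a}"
  shows "(add_link j x E)\<^sup>* `` {a} = (if a \<in> C j \<union> C x then C j \<union> C x else C a)"
proof -
  have R: "(p, q) \<in> E\<^sup>* \<longleftrightarrow> C p = C q" for p q
    unfolding C_def using Image_rtrancl_eq_iff[OF assms(1)] by simp
  have C: "p \<in> C q \<longleftrightarrow> C p = C q" for p q
    using R[of q p] by (auto simp: C_def)
  have "(a, b) \<in> (add_link j x E)\<^sup>* \<longleftrightarrow> b \<in> (if a \<in> C j \<union> C x then C j \<union> C x else C a)" for b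
    unfolding add_link_def rtrancl_insert
    by (cases "C a = C j"; cases "C a = C x"; cases "C b = C j"; cases "C b = C x") (simp_all add: R C eq_commute)
  then show ?thesis by blast
qed

lemma components_add_link:
  assumes E: "sym E" and jx: "j \<in> A" "x \<in> A" "(j, x) \<notin> E\<^sup>*" and "finite A"
  defines "C \<equiv> \<lambda>a. E\<^sup>* `` {a}"
  shows "components A (add_link j x E) = insert (C j \<union> C x) (components A E - {C j, C x})"
    and "card (components A E) = card (components A (add_link j x E)) + 1"
proof -
  note eq = Image_rtrancl_eq_iff[OF E]
  have eq_iff: "a \<in> C b \<longleftrightarrow> C a = C b" for a b
    using eq[of b a] by (auto simp: C_def)
  have img: "(add_link j x E)\<^sup>* `` {a} = (if C a = C j \<or> C a = C x then C j \<union> C x else C a)" for a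
    using Image_add_link[OF E, of j x a] eq_iff by (simp add: C_def)
  have component: "components A E = C ` A" by (simp add: components_def C_def)
  show 1: "components A (add_link j x E) = insert (C j \<union> C x) (components A E - {C j, C x})"
    unfolding components_def[of A "add_link j x E"] img component using jx(1) by auto
  have ne: "C j \<noteq> C x" using jx(3) eq by (auto simp: C_def)
  have "C j \<union> C x \<notin> components A E"
  proof
    assume "C j \<union> C x \<in> components A E"
    then obtain a where "C j \<union> C x = C a" by (auto simp: component)
    then have "j \<in> C a" "x \<in> C a" by (auto simp: C_def)
    then show False using ne eq_iff by metis
  qed
  moreover have "card (components A E) \<ge> card {C j, C x}"
    using jx \<open>finite A\<close> by (intro card_mono) (auto simp: component)
  ultimately show "card (components A E) = card (components A (add_link j x E)) + 1"
    unfolding 1 using \<open>finite A\<close> jx ne by (simp add: component card_Diff_subset)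
qed

section \<open>Perfect matchings on a linearly ordered set, compared with a base matching
  \<open>t\<close>\<close>

locale paired_set =
  fixes \<Omega> :: "'a::linorder set" and t :: "'a \<Rightarrow> 'a"
  assumes fin: "finite \<Omega>" and t_permutes: "t permutes \<Omega>"
    and t_t [simp]: "t (t a) = a" and t_neq: "a \<in> \<Omega> \<Longrightarrow> t a \<noteq> a"
begin

text \<open>The larger element of each pair of \<open>t\<close>; for
  \<open>pair_involution n\<close> these are the even numbers up to 2n. They stand for the pairs and
  index the operators.\<close>

definition I :: "'a set" where
  "I = {x \<in> \<Omega>. t x < x}"

text \<open>A perfect matching is encoded as the fixed point free involution that exchanges
  partners, so that permutations act on it by conjugation.\<close>

definition matching :: "('a \<Rightarrow> 'a) \<Rightarrow> bool" where
  "matching m \<longleftrightarrow> m permutes \<Omega> \<and> (\<forall>a. m (m a) = a) \<and> (\<forall>a\<in>\<Omega>. m a \<noteq> a)"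

definition links :: "('a \<Rightarrow> 'a) \<Rightarrow> ('a \<times> 'a) set" where
  "links m = {(a, t a) | a. a \<in> \<Omega>} \<union> {(a, m a) | a. a \<in> \<Omega>}"

definition component :: "('a \<Rightarrow> 'a) \<Rightarrow> 'a \<Rightarrow> 'a set" where
  "component m a = (links m)\<^sup>* `` {a}"

definition comps :: "('a \<Rightarrow> 'a) \<Rightarrow> 'a set set" where
  "comps m = components \<Omega> (links m)"

text \<open>A component made of c pairs contributes c - 1 copies of its largest element. The type of
  this multiset is the coset type with all parts lowered by one and zeros dropped; the multiset
  itself is the monomial that reaches \<open>m\<close> from \<open>t\<close> with coefficient
  1.\<close>

definition excess :: "('a \<Rightarrow> 'a) \<Rightarrow> 'a multiset" where
  "excess m = (\<Sum>D\<in>comps m. replicate_mset (card (D \<inter> I) - 1) (Max D))"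

lemma I_subset: "I \<subseteq> \<Omega>" by (auto simp: I_def)

lemma finite_I: "finite I" using fin by (simp add: I_def)

lemma t_in_iff [simp]: "t a \<in> \<Omega> \<longleftrightarrow> a \<in> \<Omega>"
  using t_permutes by (rule permutes_in_image)

lemma t_eq_iff [simp]: "t a = t b \<longleftrightarrow> a = b"
  by (metis t_t)

lemma matchingD:
  assumes "matching m"
  shows "m permutes \<Omega>" "m (m a) = a" "a \<in> \<Omega> \<Longrightarrow> m a \<noteq> a" "m a \<in> \<Omega> \<longleftrightarrow> a \<in> \<Omega>"
  using assms permutes_in_image by (fastforce simp: matching_def)+

lemma matching_t: "matching t"
  using t_permutes t_neq by (simp add: matching_def)

lemma matching_conj:
  assumes "matching m" "p permutes \<Omega>"
  shows "matching (Hilbert_Choice.inv p \<circ> m \<circ> p)"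
proof -
  note p = permutes_inverses[OF assms(2)] permutes_in_image[OF assms(2)]
  show ?thesis
    unfolding matching_def using matchingD[OF assms(1)] p assms(2)
    by (auto intro!: permutes_compose permutes_inv) (metis p(1))
qed

lemma sym_links: "matching m \<Longrightarrow> sym (links m)"
  unfolding sym_def links_def by (auto simp: matchingD)

lemma comp_eq_iff: "matching m \<Longrightarrow> b \<in> component m a \<longleftrightarrow> component m b = component m a"
  using Image_rtrancl_eq_iff[OF sym_links, of m a b] by (auto simp: component_def)

lemma self_in_comp: "a \<in> component m a"
  by (simp add: component_def)

lemma comp_subset: "matching m \<Longrightarrow> a \<in> \<Omega> \<Longrightarrow> component m a \<subseteq> \<Omega>"
proof
  fix b assume m: "matching m" "a \<in> \<Omega>" "b \<in> component m a"
  then have "(a, b) \<in> (links m)\<^sup>*" by (simp add: component_def)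
  then show "b \<in> \<Omega>" by induction (use m in \<open>auto simp: links_def matchingD\<close>)
qed

lemma comps_eq: "comps m = component m ` \<Omega>"
  by (simp add: comps_def components_def component_def)

lemma finite_comps: "finite (comps m)"
  using fin by (simp add: comps_eq)

lemma comps_subset: "matching m \<Longrightarrow> D \<in> comps m \<Longrightarrow> D \<subseteq> \<Omega>"
  using comp_subset by (auto simp: comps_eq)

lemma comps_finite: "matching m \<Longrightarrow> D \<in> comps m \<Longrightarrow> finite D"
  using comps_subset fin finite_subset by metis

lemma comps_nonempty: "D \<in> comps m \<Longrightarrow> D \<noteq> {}"
  using self_in_comp by (auto simp: comps_eq)

lemma comps_disjoint: "matching m \<Longrightarrow> D \<in> comps m \<Longrightarrow> D' \<in> comps m \<Longrightarrow> a \<in> D \<Longrightarrow> a \<in> D' \<Longrightarrow> D = D'"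
  unfolding comps_eq using comp_eq_iff by blast

lemma comps_closed:
  assumes "matching m" "D \<in> comps m" "a \<in> D"
  shows "t a \<in> D" "m a \<in> D" "component m a = D"
proof -
  obtain b where b: "b \<in> \<Omega>" "D = component m b" using assms(2) by (auto simp: comps_eq)
  show D: "component m a = D" using assms b comp_eq_iff by blast
  have "a \<in> \<Omega>" using assms comps_subset by blast
  then have "(a, t a) \<in> (links m)\<^sup>*" "(a, m a) \<in> (links m)\<^sup>*"
    by (auto simp: links_def)
  then show "t a \<in> D" "m a \<in> D" using D by (auto simp: component_def)
qed

lemma comp_in_comps: "a \<in> \<Omega> \<Longrightarrow> component m a \<in> comps m"
  by (simp add: comps_eq)

lemma comp_minimal:
  assumes "a \<in> S" "\<And>b. b \<in> S \<Longrightarrow> t b \<in> S" "\<And>b. b \<in> S \<Longrightarrow> m b \<in> S"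
  shows "component m a \<subseteq> S"
proof
  fix b assume "b \<in> component m a"
  then have "(a, b) \<in> (links m)\<^sup>*" by (simp add: component_def)
  then show "b \<in> S" by induction (use assms in \<open>auto simp: links_def\<close>)
qed

lemma card_t_closed:
  assumes "D \<subseteq> \<Omega>" "\<And>a. a \<in> D \<Longrightarrow> t a \<in> D"
  shows "card D = 2 * card (D \<inter> I)"
proof -
  have "D = (D \<inter> I) \<union> t ` (D \<inter> I)"
  proof -
    have "a \<in> t ` (D \<inter> I)" if "a \<in> D" "a \<notin> I" for a
    proof (rule image_eqI[of _ _ "t a"])
      have "t a < a \<or> a < t a" using t_neq[of a] that assms by auto
      then show "t a \<in> D \<inter> I" using that assms by (auto simp: I_def)
    qed simp
    then show ?thesis using assms by blast
  qed
  moreover have "(D \<inter> I) \<inter> t ` (D \<inter> I) = {}" by (auto simp: I_def)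
  moreover have "finite (D \<inter> I)" using finite_I by simp
  ultimately have "card D = card (D \<inter> I) + card (t ` (D \<inter> I))"
    by (metis card_Un_disjoint finite_imageI)
  also have "card (t ` (D \<inter> I)) = card (D \<inter> I)"
    by (intro card_image) (auto simp: inj_on_def)
  finally show ?thesis by simp
qed

lemma Max_comps:
  assumes "matching m" "D \<in> comps m"
  shows "Max D \<in> D" "Max D \<in> I"
proof -
  show D: "Max D \<in> D"
    using assms comps_finite comps_nonempty by (simp add: Max_in)
  moreover have "t (Max D) \<in> D" using D assms comps_closed by blast
  ultimately have "t (Max D) \<le> Max D" "Max D \<in> \<Omega>"
    using Max_ge[OF comps_finite[OF assms]] comps_subset[OF assms] by auto
  then show "Max D \<in> I" using t_neq by (auto simp: I_def order_le_less)
qed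

lemma card_comps_I_pos: "matching m \<Longrightarrow> D \<in> comps m \<Longrightarrow> card (D \<inter> I) > 0"
  using Max_comps finite_I unfolding card_gt_0_iff by blast

lemma sum_card_comps:
  assumes "matching m"
  shows "(\<Sum>D\<in>comps m. card (D \<inter> I)) = card I"
proof -
  have "I = (\<Union>D\<in>comps m. D \<inter> I)"
    using self_in_comp I_subset by (fastforce simp: comps_eq)
  then have "card I = card (\<Union>D\<in>comps m. D \<inter> I)" by (rule arg_cong)
  also have "\<dots> = (\<Sum>D\<in>comps m. card (D \<inter> I))"
  proof (intro card_UN_disjoint finite_comps ballI impI)
    fix D D' assume "D \<in> comps m" "D' \<in> comps m" "D \<noteq> D'"
    then have "D \<inter> D' = {}" using comps_disjoint[OF assms] by blast
    then show "D \<inter> I \<inter> (D' \<inter> I) = {}" by blast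
  qed (use finite_I in simp)
  finally show ?thesis ..
qed

lemma size_excess:
  assumes "matching m"
  shows "size (excess m) + card (comps m) = card I"
proof -
  have "size (excess m) + card (comps m) = (\<Sum>D\<in>comps m. (card (D \<inter> I) - 1) + 1)"
    by (simp only: excess_def size_multiset_sum sum.distrib) simp
  also have "\<dots> = (\<Sum>D\<in>comps m. card (D \<inter> I))"
    using card_comps_I_pos[OF assms] by (intro sum.cong) auto
  finally show ?thesis using sum_card_comps[OF assms] by simp
qed

lemma count_excess:
  assumes "matching m" "D \<in> comps m" "x \<in> D"
  shows "count (excess m) x = (if x = Max D then card (D \<inter> I) - 1 else 0)"
proof -
  have "count (excess m) x = (\<Sum>D'\<in>comps m. if D' = D then if x = Max D then card (D \<inter> I) - 1 else 0 else 0)"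
    unfolding excess_def count_sum
  proof (rule sum.cong)
    fix D' assume D': "D' \<in> comps m"
    have "x \<noteq> Max D'" if "D' \<noteq> D"
      using comps_disjoint[OF assms(1) D' assms(2), of x] Max_comps(1)[OF assms(1) D'] that assms(3) by metis
    then show "count (replicate_mset (card (D' \<inter> I) - 1) (Max D')) x
        = (if D' = D then if x = Max D then card (D \<inter> I) - 1 else 0 else 0)"
      by auto
  qed simp
  then show ?thesis using finite_comps assms(2) by simp
qed

lemma count_excess_outside:
  assumes "matching m" "x \<notin> \<Omega>"
  shows "count (excess m) x = 0"
  unfolding excess_def count_sum
  using assms Max_comps(2) I_subset by (intro sum.neutral) force

lemma set_excess:
  assumes "matching m"
  shows "set_mset (excess m) = Max ` {D \<in> comps m. card (D \<inter> I) > 1}"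
  using Max_comps[OF assms] finite_comps
  by (auto simp: excess_def set_mset_sum split: if_splits)

lemma set_excess_subset: "matching m \<Longrightarrow> set_mset (excess m) \<subseteq> I"
  using set_excess Max_comps by auto

lemma inj_on_Max_comps: "matching m \<Longrightarrow> inj_on Max (comps m)"
  using Max_comps comps_disjoint by (metis inj_onI)

lemma comp_t: "a \<in> \<Omega> \<Longrightarrow> component t a = {a, t a}"
proof
  show "component t a \<subseteq> {a, t a}" by (rule comp_minimal) auto
  assume "a \<in> \<Omega>"
  then show "{a, t a} \<subseteq> component t a"
    using comps_closed(1)[OF matching_t comp_in_comps self_in_comp] self_in_comp by simp
qed

lemma comps_trivial:
  assumes "matching m" "D \<in> comps m" "card (D \<inter> I) = 1" "a \<in> D"
  shows "D = {a, t a}"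
proof -
  have "card D = 2"
    using assms comps_subset comps_closed card_t_closed[of D] by simp
  moreover have "a \<in> \<Omega>" using assms comps_subset by blast
  then have "card {a, t a} = 2" using t_neq[of a] by auto
  moreover have "{a, t a} \<subseteq> D" using assms comps_closed by blast
  ultimately show ?thesis
    using comps_finite[OF assms(1,2)] by (metis card_subset_eq)
qed

lemma excess_empty_iff:
  assumes "matching m"
  shows "excess m = {#} \<longleftrightarrow> m = t"
proof
  assume e: "excess m = {#}"
  have "m a = t a" for a
  proof (cases "a \<in> \<Omega>")
    case True
    let ?D = "component m a"
    have D: "?D \<in> comps m" "a \<in> ?D" using True comp_in_comps self_in_comp by auto
    have "\<not> card (?D \<inter> I) > 1" using e set_excess[OF assms] D by auto
    then have "card (?D \<inter> I) = 1" using card_comps_I_pos[OF assms D(1)] by linarith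
    then have "?D = {a, t a}" using comps_trivial assms D by blast
    then show ?thesis
      using comps_closed(2)[OF assms D] matchingD(3)[OF assms True] by auto
  next
    case False
    then show ?thesis
      using matchingD(1)[OF assms] t_permutes by (simp add: permutes_not_in)
  qed
  then show "m = t" by auto
next
  assume m: "m = t"
  have 1: "card (component t a \<inter> I) = 1" if "a \<in> \<Omega>" for a
  proof -
    have "t a < a \<or> a < t a" using t_neq[OF that] by auto
    then have "{a, t a} \<inter> I = {a} \<or> {a, t a} \<inter> I = {t a}"
      using that by (auto simp: I_def)
    then show ?thesis using comp_t[OF that] by auto
  qed
  have "{D \<in> comps t. card (D \<inter> I) > 1} = {}"
    using 1 unfolding comps_eq by fastforce
  then have "set_mset (excess t) = {}"
    using set_excess[OF matching_t] by simp
  then show "excess m = {#}" using m by simp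
qed

section \<open>Effect of conjugation by one transposition on the components\<close>

lemma matching_transpose_conj:
  assumes "matching m" "j \<in> \<Omega>" "x \<in> \<Omega>"
  shows "matching (transpose j x \<circ> m \<circ> transpose j x)"
  using matching_conj[OF assms(1) permutes_swap_id[OF assms(2,3)]] by simp

text \<open>Once \<open>j\<close> and \<open>x\<close> are linked, every element is connected to its
  image under the transposition. The edge from \<open>a\<close> to \<open>m a\<close> is replaced by
  the edge of the conjugate between the two images, with a link at either end.\<close>

lemma links_transpose_conj_subset:
  assumes "j \<in> \<Omega>" "x \<in> \<Omega>"
  shows "links m \<subseteq> (add_link j x (links (transpose j x \<circ> m \<circ> transpose j x)))\<^sup>*" (is "_ \<subseteq> ?E\<^sup>*")
proof
  let ?m = "transpose j x \<circ> m \<circ> transpose j x"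
  have tau: "(b, transpose j x b) \<in> ?E\<^sup>*" "(transpose j x b, b) \<in> ?E\<^sup>*" for b
    by (auto simp: transpose_def add_link_def)
  fix e assume "e \<in> links m"
  then obtain a where a: "a \<in> \<Omega>" "e = (a, t a) \<or> e = (a, m a)" by (auto simp: links_def)
  have "transpose j x a \<in> \<Omega>" using a(1) assms by (auto simp: transpose_def)
  then have "(transpose j x a, ?m (transpose j x a)) \<in> links ?m"
    unfolding links_def by blast
  then have "(transpose j x a, transpose j x (m a)) \<in> ?E\<^sup>*"
    by (auto simp: add_link_def)
  then have "(a, m a) \<in> ?E\<^sup>*"
    using tau by (meson rtrancl_trans)
  moreover have "(a, t a) \<in> ?E\<^sup>*"
    using a(1) by (auto simp: add_link_def links_def)
  ultimately show "e \<in> ?E\<^sup>*" using a(2) by auto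
qed

lemma links_transpose_conj:
  assumes "j \<in> \<Omega>" "x \<in> \<Omega>"
  shows "(add_link j x (links (transpose j x \<circ> m \<circ> transpose j x)))\<^sup>* = (add_link j x (links m))\<^sup>*"
proof -
  let ?c = "\<lambda>m. transpose j x \<circ> m \<circ> transpose j x"
  have sub: "(add_link j x (links m))\<^sup>* \<subseteq> (add_link j x (links (?c m)))\<^sup>*" for m
    using links_transpose_conj_subset[OF assms, of m]
    by (intro rtrancl_subset_rtrancl) (auto simp: add_link_def)
  have "?c (?c m) = m" by (simp add: fun_eq_iff)
  then show ?thesis using sub[of m] sub[of "?c m"] by simp
qed

text \<open>Connecting \<open>j\<close> and \<open>x\<close> turns the components of \<open>m\<close> and of its conjugate \<open>m'\<close> into the
  same partition, so their numbers differ by at most one.\<close>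

lemma comps_transpose_conj:
  assumes m: "matching m" and j: "j \<in> \<Omega>" "x \<in> \<Omega>"
    and m': "m' = transpose j x \<circ> m \<circ> transpose j x"
  shows "card (comps m') \<le> card (comps m) + 1"
    and "card (comps m') = card (comps m) + 1 \<Longrightarrow> x \<in> component m j \<and> x \<notin> component m' j"
    and "x \<in> component m j \<Longrightarrow> x \<notin> component m' j \<Longrightarrow>
           comps m = insert (component m' j \<union> component m' x) (comps m' - {component m' j, component m' x}) \<and>
           card (comps m') = card (comps m) + 1"
proof -
  let ?Q = "components \<Omega> (add_link j x (links m))"
  have m'm: "matching m'" unfolding m' by (rule matching_transpose_conj[OF m j])
  note s = sym_links[OF m] sym_links[OF m'm]
  have Q: "?Q = components \<Omega> (add_link j x (links m'))"
    unfolding components_def m' links_transpose_conj[OF j] ..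
  have le: "card ?Q \<le> card (comps m)"
    unfolding comps_def using fin subset_add_link by (rule card_components_coarser)
  have same: "?Q = comps m'" if "x \<in> component m' j"
    unfolding Q unfolding comps_def components_def using that s by (simp add: add_link_connected component_def)
  have diff: "card (comps m') = card ?Q + 1"
    "?Q = insert (component m' j \<union> component m' x) (comps m' - {component m' j, component m' x})" if "x \<notin> component m' j"
    unfolding Q unfolding comps_def component_def using components_add_link[OF s(2) j _ fin] that
    by (auto simp: component_def)
  show 1: "card (comps m') \<le> card (comps m) + 1"
    using le same diff(1) by (cases "x \<in> component m' j") auto
  show "x \<in> component m j \<and> x \<notin> component m' j" if c: "card (comps m') = card (comps m) + 1"
  proof
    show n: "x \<notin> component m' j" using le same c by auto
    then have "card ?Q = card (components \<Omega> (links m))"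
      using diff(1) c by (simp add: comps_def)
    then have "(j, x) \<in> (links m)\<^sup>*"
      by (rule components_coarser_same_card[OF fin s(1) subset_add_link _ j _ sym_add_link[OF s(1)]])
        (auto simp: add_link_def)
    then show "x \<in> component m j" by (simp add: component_def)
  qed
  show "comps m = insert (component m' j \<union> component m' x) (comps m' - {component m' j, component m' x}) \<and>
        card (comps m') = card (comps m) + 1" if "x \<in> component m j" "x \<notin> component m' j"
  proof -
    have "?Q = comps m"
      unfolding comps_def components_def using that s by (simp add: add_link_connected component_def)
    then show ?thesis using diff[OF that(2)] by simp
  qed
qed

text \<open>The trace left in \<open>m\<close> by a product of transpositions of \<open>j\<close>
  and \<open>x\<close>, with \<beta> listing the upper entries \<open>x\<close>, in which every step
  merged two components. A component of c pairs has absorbed c - 1 steps, whence the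
  \<open>+ 1\<close>, and if it is nontrivial, its largest element was the upper entry of one of
  them.\<close>

definition compatible :: "'a multiset \<Rightarrow> ('a \<Rightarrow> 'a) \<Rightarrow> bool" where
  "compatible \<beta> m \<longleftrightarrow> (\<forall>D\<in>comps m. (\<Sum>y\<in>D. count \<beta> y) + 1 = card (D \<inter> I) \<and>
     (card (D \<inter> I) > 1 \<longrightarrow> Max D \<in># \<beta>))"

lemma card_comps_t: "D \<in> comps t \<Longrightarrow> card (D \<inter> I) = 1"
  using excess_empty_iff[OF matching_t] set_excess[OF matching_t] card_comps_I_pos[OF matching_t, of D]
  by fastforce

lemma compatible_empty: "compatible {#} t"
  by (simp add: compatible_def card_comps_t)

text \<open>The merged component gains the single new entry \<open>x\<close>, so the counts add up.
  If its maximum comes from the side of \<open>x\<close>, that side is either nontrivial, where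
  \<beta> already contains the maximum, or the bare pair with maximum \<open>x\<close>. If it comes
  from the side of \<open>j\<close>, it exceeds \<open>x\<close> and hence both \<open>j\<close> and
  \<open>t j\<close>, so that side is nontrivial.\<close>

lemma compatible_step:
  assumes m': "matching m'" and \<beta>: "compatible \<beta> m'" and x: "x \<in> I" and j: "j \<in> \<Omega>" "j < x" "t j < x"
    and n: "x \<notin> component m' j"
    and comps: "comps m = insert (component m' j \<union> component m' x) (comps m' - {component m' j, component m' x})"
  shows "compatible (add_mset x \<beta>) m"
  unfolding compatible_def
proof
  have xO: "x \<in> \<Omega>" using x by (simp add: I_def)
  let ?A = "component m' j" and ?B = "component m' x"
  have AB: "?A \<in> comps m'" "?B \<in> comps m'" "j \<in> ?A" "x \<in> ?B"
    using xO j comp_in_comps self_in_comp by auto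
  have fAB: "finite ?A" "finite ?B" using AB comps_finite[OF m'] by auto
  have disj: "?A \<inter> ?B = {}"
    using n AB comps_disjoint[OF m' AB(1,2)] by blast
  fix D assume D: "D \<in> comps m"
  show "(\<Sum>y\<in>D. count (add_mset x \<beta>) y) + 1 = card (D \<inter> I) \<and>
     (card (D \<inter> I) > 1 \<longrightarrow> Max D \<in># add_mset x \<beta>)"
  proof (cases "D = ?A \<union> ?B")
    case False
    then have D': "D \<in> comps m'" "D \<noteq> ?B" using D comps by auto
    then have "x \<notin> D" using comps_disjoint[OF m' _ AB(2)] AB(4) by blast
    then have "(\<Sum>y\<in>D. count (add_mset x \<beta>) y) = (\<Sum>y\<in>D. count \<beta> y)"
      by (intro sum.cong) auto
    then show ?thesis using \<beta> D' by (simp add: compatible_def)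
  next
    case True
    have "(\<Sum>y\<in>?A. count (add_mset x \<beta>) y) = (\<Sum>y\<in>?A. count \<beta> y)"
      using n by (intro sum.cong) auto
    moreover have "(\<Sum>y\<in>?B. count (add_mset x \<beta>) y) = (\<Sum>y\<in>?B. count \<beta> y) + 1"
    proof -
      have "(\<Sum>y\<in>?B. count (add_mset x \<beta>) y) = (\<Sum>y\<in>?B. count \<beta> y + (if y = x then 1 else 0))"
        by (intro sum.cong) auto
      then show ?thesis using fAB AB by (simp add: sum.distrib)
    qed
    moreover have "card (D \<inter> I) = card (?A \<inter> I) + card (?B \<inter> I)"
      unfolding True Int_Un_distrib2 using fAB disj by (intro card_Un_disjoint) auto
    ultimately have sum: "(\<Sum>y\<in>D. count (add_mset x \<beta>) y) + 1 = card (D \<inter> I)"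
      using \<beta> AB fAB disj unfolding True compatible_def by (simp add: sum.union_disjoint)
    have Max: "Max D = max (Max ?A) (Max ?B)"
      unfolding True using fAB AB by (intro Max_Un) auto
    have "Max D \<in># add_mset x \<beta>"
    proof (cases "Max ?A \<le> Max ?B")
      case True
      then have eq: "Max D = Max ?B" using Max by (simp add: max_def)
      show ?thesis
      proof (cases "card (?B \<inter> I) > 1")
        case True
        then show ?thesis using \<beta> AB eq by (simp add: compatible_def)
      next
        case False
        then have "card (?B \<inter> I) = 1" using card_comps_I_pos[OF m' AB(2)] by linarith
        then have "?B = {x, t x}" by (rule comps_trivial[OF m' AB(2) _ AB(4)])
        then have "Max D = x" using eq x by (auto simp: I_def max_def)
        then show ?thesis by simp
      qed
    next
      case False
      then have eq: "Max D = Max ?A" using Max by (simp add: max_def)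
      have "x \<le> Max ?B" using fAB AB by simp
      then have "Max ?A \<noteq> j" "Max ?A \<noteq> t j" using False j by auto
      then have "?A \<noteq> {j, t j}" using Max_comps(1)[OF m' AB(1)] by blast
      then have "card (?A \<inter> I) \<noteq> 1" using comps_trivial[OF m' AB(1) _ AB(3)] by blast
      then have "card (?A \<inter> I) > 1" using card_comps_I_pos[OF m' AB(1)] by linarith
      then show ?thesis using \<beta> AB eq by (simp add: compatible_def)
    qed
    then show ?thesis using sum by simp
  qed
qed

text \<open>Consequently \<beta> has at least as many distinct elements as \<open>m\<close> has
  nontrivial components; this comparison is the second coordinate of the triangular order.\<close>

lemma compatible_card_le:
  assumes "matching m" "compatible \<beta> m"
  shows "set_mset (excess m) \<subseteq> set_mset \<beta>"
  using assms(2) unfolding set_excess[OF assms(1)] by (auto simp: compatible_def)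

text \<open>The bound on distinct elements leaves only the maxima of the nontrivial components as
  elements of \<beta>. The quota c - 1 of each component then falls entirely on its maximum.\<close>

lemma compatible_eq_excess:
  assumes m: "matching m" and c: "compatible \<beta> m" and sub: "set_mset \<beta> \<subseteq> \<Omega>"
    and card: "card (set_mset \<beta>) \<le> card (set_mset (excess m))"
  shows "\<beta> = excess m"
proof (rule multiset_eqI)
  have eq: "set_mset \<beta> = set_mset (excess m)"
    using compatible_card_le[OF m c] card by (metis card_seteq finite_set_mset)
  fix y
  show "count \<beta> y = count (excess m) y"
  proof (cases "y \<in># \<beta>")
    case False
    then show ?thesis using eq by (metis not_in_iff)
  next
    case True
    then obtain D where D: "D \<in> comps m" "y = Max D"
      using eq set_excess[OF m] by auto
    have yD: "y \<in> D" using D Max_comps(1)[OF m] by simp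
    have "count \<beta> z = 0" if z: "z \<in> D" "z \<noteq> y" for z
    proof -
      have "count (excess m) z = 0" using count_excess[OF m D(1) z(1)] z(2) D(2) by simp
      then show ?thesis using eq by (metis not_in_iff)
    qed
    then have "(\<Sum>z\<in>D. count \<beta> z) = (\<Sum>z\<in>D. if z = y then count \<beta> y else 0)"
      by (intro sum.cong) auto
    also have "\<dots> = count \<beta> y"
      using comps_finite[OF m D(1)] yD by simp
    finally have "count \<beta> y + 1 = card (D \<inter> I)"
      using c D(1) unfolding compatible_def by metis
    then show ?thesis using count_excess[OF m D(1) yD] D(2) by simp
  qed
qed

text \<open>The partner of \<open>x\<close> is \<open>t j\<close>, and conjugation hands this
  partner to \<open>j\<close>. The pair \<open>{j, t j}\<close> is thus cut off from the component
  with largest element \<open>x\<close>, which keeps its maximum and loses one pair.\<close>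

lemma excess_step:
  assumes m: "matching m" and x: "x \<in># excess m"
  defines "j \<equiv> t (m x)"
  defines "m' \<equiv> transpose j x \<circ> m \<circ> transpose j x"
  shows "j \<in> \<Omega>" "j < x" "t j < x" "excess m = add_mset x (excess m')"
proof -
  obtain D where D: "D \<in> comps m" "x = Max D" "card (D \<inter> I) > 1"
    using x set_excess[OF m] by auto
  have xD: "x \<in> D" and xI: "x \<in> I" using Max_comps[OF m D(1)] D(2) by auto
  have xO: "x \<in> \<Omega>" and tx: "t x < x" using xI by (auto simp: I_def)
  have jD: "j \<in> D" "t j \<in> D" using comps_closed[OF m D(1)] xD by (auto simp: j_def)
  show jO: "j \<in> \<Omega>" using jD D(1) comps_subset[OF m] by blast
  have tj: "t j = m x" by (simp add: j_def)
  have "t j \<noteq> x" using tj matchingD(3)[OF m xO] by simp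
  moreover have "j \<noteq> x"
  proof
    assume "j = x"
    then have mx: "m x = t x" using tj by simp
    then have "m (t x) = x" using matchingD(2)[OF m] by metis
    then have "component m x \<subseteq> {x, t x}" using mx by (intro comp_minimal) auto
    then have "D \<inter> I \<subseteq> {x}" using comps_closed(3)[OF m D(1) xD] tx by (auto simp: I_def)
    then have "card (D \<inter> I) \<le> 1" using card_mono[of "{x}"] by fastforce
    then show False using D(3) by simp
  qed
  ultimately show jx: "j < x" "t j < x"
    using Max_ge[OF comps_finite[OF m D(1)]] jD D(2) by (simp_all add: order_less_le)
  have m'm: "matching m'" unfolding m'_def by (rule matching_transpose_conj[OF m jO xO])
  have m'j: "m' j = t j"
    using jx tj t_neq[OF jO] by (auto simp: m'_def transpose_def)
  then have "m' (t j) = j" using matchingD(2)[OF m'm] by metis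
  then have "component m' j \<subseteq> {j, t j}" using m'j by (intro comp_minimal) auto
  moreover have cj: "component m' j \<in> comps m'" using jO by (rule comp_in_comps)
  moreover have "{j, t j} \<subseteq> component m' j"
    using comps_closed(1)[OF m'm cj self_in_comp] self_in_comp by auto
  ultimately have A: "component m' j = {j, t j}" "{j, t j} \<in> comps m'" by auto
  have n: "x \<notin> component m' j" using A jx by auto
  have "x \<in> component m j" using comps_closed(3)[OF m D(1)] jD xD by simp
  then have comps: "comps m = insert ({j, t j} \<union> component m' x) (comps m' - {{j, t j}, component m' x})"
    using comps_transpose_conj(3)[OF m jO xO m'_def[THEN meta_eq_to_obj_eq]] n A by simp
  let ?B = "component m' x"
  have B: "?B \<in> comps m'" "x \<in> ?B" using xO by (auto simp: comp_in_comps self_in_comp)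
  have DB: "D = {j, t j} \<union> ?B"
    using comps_disjoint[OF m D(1) _ xD] comps B(2) by auto
  have MB: "Max ?B = x"
  proof (rule Max_eqI[OF comps_finite[OF m'm B(1)] _ B(2)])
    show "y \<le> x" if "y \<in> ?B" for y
      using Max_ge[OF comps_finite[OF m D(1)], of y] D(2) DB that by blast
  qed
  have disj: "{j, t j} \<inter> ?B = {}"
    using n A(1) B(2) comps_disjoint[OF m'm A(2) B(1)] by blast
  have "card ({j, t j} \<inter> I) = 1"
  proof -
    have "t j < j \<or> j < t j" using t_neq[OF jO] by auto
    then have "{j, t j} \<inter> I = {j} \<or> {j, t j} \<inter> I = {t j}"
      using jO by (auto simp: I_def)
    then show ?thesis by auto
  qed
  moreover have "card (D \<inter> I) = card ({j, t j} \<inter> I) + card (?B \<inter> I)"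
    unfolding DB Int_Un_distrib2 using finite_I disj by (intro card_Un_disjoint) auto
  ultimately have cD: "card (D \<inter> I) = 1 + card (?B \<inter> I)" and cA: "card ({j, t j} \<inter> I) = 1"
    by auto
  show "excess m = add_mset x (excess m')"
  proof (rule multiset_eqI)
    fix y
    consider "y \<notin> \<Omega>" | "y \<in> {j, t j}" | "y \<in> ?B" | "y \<in> \<Omega>" "y \<notin> D" using DB by auto
    then show "count (excess m) y = count (add_mset x (excess m')) y"
    proof cases
      case 1
      then show ?thesis using xO count_excess_outside[OF m] count_excess_outside[OF m'm] by auto
    next
      case 2
      then have "y \<in> D" "y \<noteq> x" using DB jx by auto
      then show ?thesis
        using count_excess[OF m D(1)] D(2) count_excess[OF m'm A(2) 2] cA by auto
    next
      case 3
      then have "y \<in> D" using DB by auto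
      then show ?thesis
        using count_excess[OF m D(1)] D(2) count_excess[OF m'm B(1) 3] cD MB
          card_comps_I_pos[OF m'm B(1)] by auto
    next
      case 4
      let ?E = "component m y"
      have E: "?E \<in> comps m" "y \<in> ?E" using 4 by (auto simp: comp_in_comps self_in_comp)
      then have "?E \<noteq> D" using 4 by auto
      then have E': "?E \<in> comps m'" using comps E(1) DB by auto
      have "y \<noteq> x" using 4 xD by auto
      then show ?thesis
        using count_excess[OF m E] count_excess[OF m'm E' E(2)] by auto
    qed
  qed
qed

text \<open>In the component of \<open>m\<close> that contains \<open>x\<close>, the excess sits at
  the maximum only, and this is \<open>x\<close>. So \<beta> has no element in the component of
  \<open>j\<close> in \<open>m'\<close>, and compatibility forces that component to be the bare pair
  \<open>{j, t j}\<close>. Undoing the conjugation gives \<open>m x = t j\<close>.\<close>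

lemma excess_step_unique:
  assumes m: "matching m" and j: "j \<in> \<Omega>" and x: "x \<in> \<Omega>"
    and m': "m' = transpose j x \<circ> m \<circ> transpose j x"
    and xj: "x \<in> component m j" "x \<notin> component m' j"
    and \<beta>: "compatible \<beta> m'" "excess m = add_mset x \<beta>"
  shows "j = t (m x)"
proof -
  have m'm: "matching m'" unfolding m' by (rule matching_transpose_conj[OF m j x])
  let ?A = "component m' j" and ?D = "component m' j \<union> component m' x"
  have A: "?A \<in> comps m'" "j \<in> ?A" using j by (auto simp: comp_in_comps self_in_comp)
  have D: "?D \<in> comps m" using comps_transpose_conj(3)[OF m j x m' xj] by simp
  have xD: "x \<in> ?D" by (simp add: self_in_comp)
  have "count (excess m) x > 0" using \<beta>(2) by simp
  then have Max: "Max ?D = x" using count_excess[OF m D xD] by (simp split: if_splits)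
  have "count \<beta> y = 0" if "y \<in> ?A" for y
  proof -
    have "y \<noteq> x" using that xj(2) by auto
    then show ?thesis using count_excess[OF m D, of y] that Max \<beta>(2) by simp
  qed
  then have "card (?A \<inter> I) = 1"
    using \<beta>(1) A(1) unfolding compatible_def by (metis (no_types, lifting) add_0 sum.neutral)
  then have Ajt: "?A = {j, t j}" using comps_trivial[OF m'm A(1) _ A(2)] by blast
  then have "m' j = t j"
    using comps_closed(2)[OF m'm A] matchingD(3)[OF m'm j] by auto
  moreover have "j \<noteq> x" "t j \<noteq> x" using Ajt xj(2) by auto
  moreover have "transpose j x (m' j) = m x" unfolding m' by simp
  ultimately have "m x = t j" using t_neq[OF j] by (simp add: transpose_def)
  then show ?thesis by simp
qed

end

section \<open>Conjugacy of matchings\<close>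

lemma least_power_eq_iff:
  assumes s: "permutation s"
  shows "(s ^^ i) x = (s ^^ j) x \<longleftrightarrow> i mod least_power s x = j mod least_power s x"
proof -
  have *: "(s ^^ i) x = (s ^^ j) x \<longleftrightarrow> i mod least_power s x = j mod least_power s x" if "i \<le> j" for i j
  proof -
    have inj: "inj (s ^^ i)" using permutation_bijective[OF s] by (simp add: bij_is_inj inj_fn)
    have "(s ^^ j) x = (s ^^ i) ((s ^^ (j - i)) x)"
      using that funpow_add[of i "j - i" s] by simp
    then have "(s ^^ i) x = (s ^^ j) x \<longleftrightarrow> (s ^^ (j - i)) x = x"
      using injD[OF inj, of x "(s ^^ (j - i)) x"] by auto
    also have "\<dots> \<longleftrightarrow> least_power s x dvd j - i"
      using least_power_dvd[OF s] by simp
    also have "\<dots> \<longleftrightarrow> i mod least_power s x = j mod least_power s x"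
      using mod_eq_dvd_iff_nat[OF that, of "least_power s x"] by auto
    finally show ?thesis .
  qed
  show ?thesis using *[of i j] *[of j i] by (cases i j rule: le_cases) auto
qed

lemma card_orbit_least_power:
  assumes s: "permutation s"
  shows "card (range (\<lambda>i. (s ^^ i) x)) = least_power s x"
proof -
  let ?p = "least_power s x"
  have p: "?p > 0" using least_power_of_permutation(2)[OF s] by simp
  have "range (\<lambda>i. (s ^^ i) x) = (\<lambda>i. (s ^^ i) x) ` {..<?p}"
  proof -
    have "(s ^^ i) x = (s ^^ (i mod ?p)) x" for i by (simp add: least_power_eq_iff[OF s])
    then show ?thesis using p by (fastforce intro: mod_less_divisor)
  qed
  moreover have "inj_on (\<lambda>i. (s ^^ i) x) {..<?p}"
    by (rule inj_onI) (simp add: least_power_eq_iff[OF s])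
  ultimately show ?thesis by (simp add: card_image)
qed

section \<open>Traversing a component by alternating steps\<close>

context paired_set
begin

text \<open>Two steps along a cycle, an edge of \<open>m\<close> and then an edge of
  \<open>t\<close>. A component consists of two disjoint orbits of this permutation, exchanged by
  \<open>t\<close>.\<close>

definition turn :: "('a \<Rightarrow> 'a) \<Rightarrow> 'a \<Rightarrow> 'a" where
  "turn m = t \<circ> m"

lemma permutation_turn: "matching m \<Longrightarrow> permutation (turn m)"
  unfolding turn_def using fin permutes_compose[OF matchingD(1) t_permutes]
  by (auto simp: permutation_permutes)

lemma turn_in: "matching m \<Longrightarrow> x \<in> \<Omega> \<Longrightarrow> (turn m ^^ i) x \<in> \<Omega>"
  by (induction i) (auto simp: turn_def matchingD)

lemma m_turn: "m ((turn m ^^ i) x) = t ((turn m ^^ Suc i) x)"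
  by (simp add: turn_def)

lemma m_t_turn: "matching m \<Longrightarrow> m (t ((turn m ^^ Suc i) x)) = (turn m ^^ i) x"
  by (simp add: turn_def matchingD(2))

text \<open>If d + 2 turns lead from \<open>x\<close> to \<open>t x\<close>, then d turns lead from
  \<open>turn m x\<close> to its own partner under \<open>t\<close>. The descent ends with a fixed
  point of \<open>t\<close> at zero turns or of \<open>m\<close> at one turn.\<close>

lemma turn_neq_t:
  assumes m: "matching m" and "x \<in> \<Omega>"
  shows "(turn m ^^ d) x \<noteq> t x"
  using assms(2)
proof (induction d arbitrary: x rule: induct_nat_012)
  case 0
  then show ?case using t_neq[of x] by auto
next
  case 1
  then show ?case using matchingD(3)[OF m] by (auto simp: turn_def)
next
  case (ge2 d)
  show ?case
  proof
    assume "(turn m ^^ Suc (Suc d)) x = t x"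
    then have "turn m ((turn m ^^ d) (turn m x)) = t x" by (simp add: funpow_swap1)
    then have "m ((turn m ^^ d) (turn m x)) = x" by (simp add: turn_def)
    then have "(turn m ^^ d) (turn m x) = t (turn m x)"
      using matchingD(2)[OF m] by (metis turn_def comp_apply t_t)
    moreover have "turn m x \<in> \<Omega>" using ge2.prems turn_in[OF m, of x 1] by simp
    ultimately show False using ge2.IH(1) by blast
  qed
qed

lemma turn_neq_t_turn:
  assumes m: "matching m" and x: "x \<in> \<Omega>"
  shows "(turn m ^^ i) x \<noteq> t ((turn m ^^ j) x)"
proof -
  have *: "(turn m ^^ i) x \<noteq> t ((turn m ^^ j) x)" if "j \<le> i" for i j
  proof -
    have "(turn m ^^ i) x = (turn m ^^ (i - j)) ((turn m ^^ j) x)"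
      using that funpow_add[of "i - j" j "turn m"] by simp
    then show ?thesis using turn_neq_t[OF m turn_in[OF m x, of j], of "i - j"] by simp
  qed
  show ?thesis
  proof (cases "j \<le> i")
    case True
    then show ?thesis by (rule *)
  next
    case False
    then have "(turn m ^^ j) x \<noteq> t ((turn m ^^ i) x)" by (intro *) simp
    then show ?thesis by (metis t_t)
  qed
qed

text \<open>Exponents are natural numbers, so a step back from \<open>i = 0\<close> is possible only
  after adding the period.\<close>

lemma turn_pred:
  assumes "matching m"
  obtains k where "(turn m ^^ i) x = (turn m ^^ Suc k) x"
proof
  let ?p = "least_power (turn m) x"
  have s: "permutation (turn m)" by (rule permutation_turn[OF assms])
  have "?p > 0" using least_power_of_permutation(2)[OF s] by simp
  then have "Suc (i + ?p - 1) = i + ?p" by simp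
  then show "(turn m ^^ i) x = (turn m ^^ Suc (i + ?p - 1)) x"
    by (simp only: least_power_eq_iff[OF s]) simp
qed

lemma comp_turn:
  assumes m: "matching m" and x: "x \<in> \<Omega>"
  shows "component m x = range (\<lambda>i. (turn m ^^ i) x) \<union> range (\<lambda>i. t ((turn m ^^ i) x))" (is "_ = ?S")
proof
  show "component m x \<subseteq> ?S"
  proof (rule comp_minimal)
    have "(turn m ^^ 0) x \<in> ?S" by blast
    then show "x \<in> ?S" by simp
  next
    fix b assume "b \<in> ?S"
    then show "t b \<in> ?S" by auto
  next
    fix b assume "b \<in> ?S"
    then consider i where "b = (turn m ^^ i) x" | i where "b = t ((turn m ^^ i) x)" by blast
    then show "m b \<in> ?S"
    proof cases
      case 1
      then show ?thesis using m_turn[of m] by blast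
    next
      case (2 i)
      obtain k where "(turn m ^^ i) x = (turn m ^^ Suc k) x" by (rule turn_pred[OF m])
      then have "m b = (turn m ^^ k) x" using 2 m_t_turn[OF m] by metis
      then show ?thesis by blast
    qed
  qed
  have D: "component m x \<in> comps m" by (rule comp_in_comps[OF x])
  have "(turn m ^^ i) x \<in> component m x" for i
    by (induction i) (auto simp: turn_def self_in_comp intro: comps_closed[OF m D])
  then show "?S \<subseteq> component m x" using comps_closed(1)[OF m D] by blast
qed

lemma card_comp_turn:
  assumes m: "matching m" and x: "x \<in> \<Omega>"
  shows "card (component m x) = 2 * least_power (turn m) x"
proof -
  let ?R = "range (\<lambda>i. (turn m ^^ i) x)"
  have "finite (component m x)" using comps_finite[OF m comp_in_comps[OF x]] .
  then have "finite ?R" unfolding comp_turn[OF m x] by simp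
  moreover have "range (\<lambda>i. t ((turn m ^^ i) x)) = t ` ?R" by auto
  moreover have "?R \<inter> t ` ?R = {}" using turn_neq_t_turn[OF m x] by auto
  moreover have "card (t ` ?R) = card ?R" by (intro card_image) (auto simp: inj_on_def)
  ultimately show ?thesis
    unfolding comp_turn[OF m x]
    by (simp add: card_Un_disjoint card_orbit_least_power[OF permutation_turn[OF m]])
qed

text \<open>Equal cardinality means equal period, so sending the i-th turn of \<open>x\<close> to
  the i-th turn of \<open>y\<close>, and partners under \<open>t\<close> to partners under
  \<open>t\<close>, is well defined. The map respects the matchings because these shift the number
  of turns by one, up to \<open>t\<close>.\<close>

lemma comp_iso:
  assumes m: "matching m" and m': "matching m'" and x: "x \<in> \<Omega>" and y: "y \<in> \<Omega>"
    and card: "card (component m x) = card (component m' y)"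
  shows "\<exists>g. bij_betw g (component m x) (component m' y) \<and>
    (\<forall>z\<in>component m x. g (t z) = t (g z) \<and> g (m z) = m' (g z))"
proof -
  let ?a = "\<lambda>i. (turn m ^^ i) x" and ?b = "\<lambda>i. (turn m' ^^ i) y"
  have "least_power (turn m) x = least_power (turn m') y"
    using card card_comp_turn[OF m x] card_comp_turn[OF m' y] by simp
  then have ab: "?a i = ?a j \<longleftrightarrow> ?b i = ?b j" for i j
    using least_power_eq_iff[OF permutation_turn[OF m]] least_power_eq_iff[OF permutation_turn[OF m']]
    by simp
  define g where "g z = (if z \<in> range ?a then ?b (SOME i. z = ?a i) else t (?b (SOME i. z = t (?a i))))" for z
  have ga: "g (?a i) = ?b i" for i
  proof -
    have "?a i = ?a (SOME j. ?a i = ?a j)" by (rule someI) (rule refl)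
    then have "?b i = ?b (SOME j. ?a i = ?a j)" using ab by blast
    then show ?thesis by (simp add: g_def)
  qed
  have gta: "g (t (?a i)) = t (?b i)" for i
  proof -
    have "t (?a i) \<notin> range ?a"
    proof
      assume "t (?a i) \<in> range ?a"
      then obtain j where "t (?a i) = ?a j" by (rule rangeE)
      then show False using turn_neq_t_turn[OF m x, of j i] by (rule notE[OF _ sym, rotated])
    qed
    moreover have "t (?a i) = t (?a (SOME j. t (?a i) = t (?a j)))" by (rule someI) (rule refl)
    then have "?b i = ?b (SOME j. t (?a i) = t (?a j))" by (rule ab[THEN iffD1, OF t_eq_iff[THEN iffD1]])
    ultimately show ?thesis by (simp add: g_def)
  qed
  have "g ` component m x = component m' y"
    unfolding comp_turn[OF m x] comp_turn[OF m' y] image_Un image_image ga gta ..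
  moreover have "finite (component m x)" using comps_finite[OF m comp_in_comps[OF x]] .
  ultimately have "bij_betw g (component m x) (component m' y)"
    using card by (simp add: bij_betw_def eq_card_imp_inj_on)
  moreover have "g (t z) = t (g z) \<and> g (m z) = m' (g z)" if "z \<in> component m x" for z
  proof -
    from that consider i where "z = ?a i" | i where "z = t (?a i)"
      unfolding comp_turn[OF m x] by blast
    then show ?thesis
    proof cases
      case (1 i)
      have "g (m (?a i)) = m' (?b i)" unfolding m_turn gta ..
      then show ?thesis using 1 ga gta by metis
    next
      case (2 i)
      obtain k where k: "?a i = ?a (Suc k)" by (rule turn_pred[OF m])
      then have z: "z = t (?a (Suc k))" using 2 by metis
      have "g (m (t (?a (Suc k)))) = m' (t (?b (Suc k)))"
        unfolding m_t_turn[OF m] m_t_turn[OF m'] by (rule ga)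
      then show ?thesis unfolding z gta t_t ga by simp
    qed
  qed
  ultimately show ?thesis by blast
qed

text \<open>The type sees only the nontrivial components. The trivial ones come back as zeros, whose
  number is known from the total number of components, so that all component sizes are
  determined.\<close>

lemma mult_type_excess:
  assumes m: "matching m"
  shows "image_mset (\<lambda>D. card (D \<inter> I) - 1) (mset_set (comps m))
    = mult_type (excess m) + replicate_mset (card (comps m) - size (mult_type (excess m))) 0"
proof -
  let ?N = "{D \<in> comps m. card (D \<inter> I) > 1}"
  have inj: "inj_on Max ?N" using inj_on_Max_comps[OF m] by (rule inj_on_subset) auto
  have "mult_type (excess m) = image_mset (\<lambda>D. count (excess m) (Max D)) (mset_set ?N)"
    unfolding mult_type_def set_excess[OF m] image_mset_mset_set[OF inj, symmetric]
    by (simp only: multiset.map_comp o_def)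
  also have "\<dots> = image_mset (\<lambda>D. card (D \<inter> I) - 1) (mset_set ?N)"
  proof (rule image_mset_cong)
    fix D assume "D \<in># mset_set ?N"
    then have D: "D \<in> comps m" using finite_comps by simp
    show "count (excess m) (Max D) = card (D \<inter> I) - 1"
      using count_excess[OF m D Max_comps(1)[OF m D]] by simp
  qed
  finally have 1: "mult_type (excess m) = image_mset (\<lambda>D. card (D \<inter> I) - 1) (mset_set ?N)" .
  have "image_mset (\<lambda>D. card (D \<inter> I) - 1) (mset_set (comps m - ?N))
      = image_mset (\<lambda>_. 0) (mset_set (comps m - ?N))"
    using finite_comps by (intro image_mset_cong) auto
  also have "\<dots> = replicate_mset (card (comps m) - size (mult_type (excess m))) 0"
    unfolding 1 using finite_comps by (simp add: image_mset_const_eq card_Diff_subset)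
  finally have 2: "image_mset (\<lambda>D. card (D \<inter> I) - 1) (mset_set (comps m - ?N))
    = replicate_mset (card (comps m) - size (mult_type (excess m))) 0" .
  have "mset_set (comps m) = mset_set ?N + mset_set (comps m - ?N)"
    using finite_comps by (subst mset_set_Union[symmetric]) (auto intro!: arg_cong[of _ _ mset_set])
  then show ?thesis using 1 2 by simp
qed

text \<open>Up to the centralizer of \<open>t\<close>, matchings are classified by their component
  sizes. Equal types give a size preserving bijection between the components, along which
  isomorphisms of single cycles are glued.\<close>

theorem matching_conjugate:
  assumes m: "matching m" and m': "matching m'"
    and type: "mult_type (excess m) = mult_type (excess m')"
  shows "\<exists>g. g permutes \<Omega> \<and> g \<circ> t = t \<circ> g \<and> g \<circ> m = m' \<circ> g"
proof -
  have "card (comps m) = card (comps m')"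
    using size_excess[OF m] size_excess[OF m'] mult_type_eq_size[OF type] by simp
  then have "image_mset (\<lambda>D. card (D \<inter> I) - 1) (mset_set (comps m))
      = image_mset (\<lambda>D. card (D \<inter> I) - 1) (mset_set (comps m'))"
    unfolding mult_type_excess[OF m] mult_type_excess[OF m'] type by simp
  from image_mset_eq_imp_bij_betw[OF finite_comps finite_comps this]
  obtain \<phi> where \<phi>: "bij_betw \<phi> (comps m) (comps m')"
    "\<forall>D\<in>comps m. card (\<phi> D \<inter> I) - 1 = card (D \<inter> I) - 1" by blast
  have "\<exists>g. bij_betw g D (\<phi> D) \<and> (\<forall>z\<in>D. g (t z) = t (g z) \<and> g (m z) = m' (g z))"
    if D: "D \<in> comps m" for D
  proof -
    have D': "\<phi> D \<in> comps m'" using \<phi>(1) D by (rule bij_betw_apply)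
    have "card (D \<inter> I) > 0" "card (\<phi> D \<inter> I) > 0"
      using card_comps_I_pos[OF m D] card_comps_I_pos[OF m' D'] by auto
    then have "card (D \<inter> I) = card (\<phi> D \<inter> I)" using \<phi>(2) D by fastforce
    then have card: "card D = card (\<phi> D)"
      using card_t_closed[OF comps_subset[OF m D] comps_closed(1)[OF m D]]
        card_t_closed[OF comps_subset[OF m' D'] comps_closed(1)[OF m' D']] by simp
    have M: "component m (Max D) = D" "component m' (Max (\<phi> D)) = \<phi> D" "Max D \<in> \<Omega>" "Max (\<phi> D) \<in> \<Omega>"
      using comps_closed(3)[OF m D] comps_closed(3)[OF m' D'] Max_comps[OF m D] Max_comps[OF m' D']
        I_subset by auto
    show ?thesis using comp_iso[OF m m' M(3,4)] M(1,2) card by simp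
  qed
  then obtain G where G: "\<And>D. D \<in> comps m \<Longrightarrow> bij_betw (G D) D (\<phi> D)"
    "\<And>D z. D \<in> comps m \<Longrightarrow> z \<in> D \<Longrightarrow> G D (t z) = t (G D z) \<and> G D (m z) = m' (G D z)"
    by metis
  define g where "g z = (if z \<in> \<Omega> then G (component m z) z else z)" for z
  have gD: "g z = G D z" if "D \<in> comps m" "z \<in> D" for D z
    using that comps_closed(3)[OF m] comps_subset[OF m] by (auto simp: g_def)
  have "g ` \<Omega> = \<Omega>"
  proof -
    have "\<Omega> = \<Union>(comps n)" if n: "matching n" for n
    proof (intro equalityI subsetI)
      show "a \<in> \<Union>(comps n)" if "a \<in> \<Omega>" for a
        using comp_in_comps[OF that, of n] self_in_comp[of a n] by blast
      show "a \<in> \<Omega>" if "a \<in> \<Union>(comps n)" for a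
        using that comps_subset[OF n] by blast
    qed
    note U = this[OF m] this[OF m']
    have "g ` \<Omega> = (\<Union>D\<in>comps m. g ` D)" by (subst U(1)) blast
    also have "\<dots> = (\<Union>D\<in>comps m. \<phi> D)"
    proof (rule SUP_cong)
      fix D assume D: "D \<in> comps m"
      have "g ` D = G D ` D" using gD[OF D] by auto
      then show "g ` D = \<phi> D" using G(1)[OF D] by (simp add: bij_betw_def)
    qed simp
    finally have "g ` \<Omega> = \<Union>(\<phi> ` comps m)" by simp
    then show ?thesis using \<phi>(1) U(2) by (simp add: bij_betw_def)
  qed
  then have "bij_betw g \<Omega> \<Omega>" using fin by (simp add: bij_betw_def eq_card_imp_inj_on)
  then have "g permutes \<Omega>" by (rule bij_imp_permutes) (simp add: g_def)
  moreover have "g (t z) = t (g z) \<and> g (m z) = m' (g z)" for z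
  proof (cases "z \<in> \<Omega>")
    case True
    let ?D = "component m z"
    have D: "?D \<in> comps m" "z \<in> ?D" using True by (auto simp: comp_in_comps self_in_comp)
    show ?thesis
      using G(2)[OF D] gD[OF D] gD[OF D(1) comps_closed(1)[OF m D]] gD[OF D(1) comps_closed(2)[OF m D]]
      by simp
  next
    case False
    then have "m z = z" "m' z = z" "t z = z"
      using matchingD(1)[OF m] matchingD(1)[OF m'] t_permutes by (auto simp: permutes_not_in)
    then show ?thesis using False by (simp add: g_def)
  qed
  ultimately show ?thesis by (auto simp: fun_eq_iff)
qed

end

section \<open>Jucys--Murphy operators\<close>

lemma sum_fun_apply: "(\<Sum>x\<in>X. f x) y = (\<Sum>x\<in>X. f x y)"
  by (induction X rule: infinite_finite_induct) auto

context paired_set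
begin

text \<open>The matching obtained by pulling \<open>t\<close> back along \<open>w\<close>. Left
  multiplication of \<open>w\<close> by \<open>K\<close> does not change it, and right
  multiplication acts by conjugation. Its edges are the edges of the second kind in the graph of
  \<open>w\<close>.\<close>

definition mat :: "('a \<Rightarrow> 'a) \<Rightarrow> 'a \<Rightarrow> 'a" where
  "mat w = Hilbert_Choice.inv w \<circ> t \<circ> w"

definition K :: "('a \<Rightarrow> 'a) set" where
  "K = {k. k permutes \<Omega> \<and> k \<circ> t = t \<circ> k}"

definition K_ind :: "('a \<Rightarrow> 'a) \<Rightarrow> int" where
  "K_ind w = (if w \<in> K then 1 else 0)"

text \<open>The condition on \<open>x\<close> stands inside the set so that \<open>JM x\<close> is
  zero for \<open>x\<close> outside \<open>I\<close>, and the operators commute for all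
  indices.\<close>

definition lower :: "'a \<Rightarrow> 'a set" where
  "lower x = {j \<in> \<Omega>. x \<in> I \<and> j < x \<and> t j < x}"

definition JM :: "'a \<Rightarrow> (('a \<Rightarrow> 'a) \<Rightarrow> int) \<Rightarrow> (('a \<Rightarrow> 'a) \<Rightarrow> int)" where
  "JM x f = (\<lambda>w. \<Sum>j\<in>lower x. f (w \<circ> transpose j x))"

lemma JM_apply: "JM x f w = (\<Sum>j\<in>lower x. f (w \<circ> transpose j x))"
  by (simp add: JM_def)

lemma matching_mat: "w permutes \<Omega> \<Longrightarrow> matching (mat w)"
  unfolding mat_def by (rule matching_conj[OF matching_t])

lemma mat_comp:
  assumes "w permutes \<Omega>" "p permutes \<Omega>"
  shows "mat (w \<circ> p) = Hilbert_Choice.inv p \<circ> mat w \<circ> p"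
  using o_inv_distrib[OF permutes_bij[OF assms(1)] permutes_bij[OF assms(2)]]
  by (simp add: mat_def o_assoc)

lemma mat_transpose:
  assumes "w permutes \<Omega>" "j \<in> \<Omega>" "x \<in> \<Omega>"
  shows "mat (w \<circ> transpose j x) = transpose j x \<circ> mat w \<circ> transpose j x"
  using mat_comp[OF assms(1) permutes_swap_id[OF assms(2,3)]] by simp

lemma mat_eq_t_iff:
  assumes "w permutes \<Omega>"
  shows "mat w = t \<longleftrightarrow> w \<in> K"
proof -
  have "mat w = t \<longleftrightarrow> w \<circ> mat w = w \<circ> t"
    using permutes_inv_o(2)[OF assms] by (metis comp_assoc id_comp)
  also have "w \<circ> mat w = t \<circ> w"
    using permutes_inv_o(1)[OF assms] by (simp add: mat_def o_assoc)
  finally show ?thesis using assms unfolding K_def by (metis (mono_tags) mem_Collect_eq)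
qed

lemma comp_transpose_permutes_iff:
  assumes "j \<in> \<Omega>" "x \<in> \<Omega>"
  shows "w \<circ> transpose j x permutes \<Omega> \<longleftrightarrow> w permutes \<Omega>"
proof
  note tau = permutes_swap_id[OF assms]
  show "w \<circ> transpose j x permutes \<Omega>" if "w permutes \<Omega>"
    using permutes_compose[OF tau that] .
  assume "w \<circ> transpose j x permutes \<Omega>"
  from permutes_compose[OF tau this] show "w permutes \<Omega>" by (simp add: comp_assoc)
qed

lemma lowerD: "j \<in> lower x \<Longrightarrow> j \<in> \<Omega> \<and> x \<in> \<Omega> \<and> x \<in> I \<and> j < x \<and> t j < x"
  using I_subset by (auto simp: lower_def)

lemma finite_lower: "finite (lower x)"
  using fin by (simp add: lower_def)

text \<open>For \<open>y < x\<close> both entries of a transposition occurring in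
  \<open>JM y\<close> belong to pairs below that of \<open>x\<close>. Conjugation by it therefore
  permutes the transpositions occurring in \<open>JM x\<close>.\<close>

lemma JM_comm_less:
  assumes "y < x"
  shows "JM x (JM y f) = JM y (JM x f)"
proof
  fix w
  let ?s = "\<lambda>j i. transpose j y i"
  have tr: "transpose j y \<circ> transpose i x = transpose (?s j i) x \<circ> transpose j y"
    if "i \<in> lower x" "j \<in> lower y" for i j
  proof
    fix z
    have "x \<noteq> j" "x \<noteq> y" "i \<noteq> x" using lowerD[OF that(1)] lowerD[OF that(2)] assms by auto
    then show "(transpose j y \<circ> transpose i x) z = (transpose (?s j i) x \<circ> transpose j y) z"
      by (auto simp: transpose_def)
  qed
  have low: "?s j i \<in> lower x" if "i \<in> lower x" "j \<in> lower y" for i j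
    using lowerD[OF that(1)] lowerD[OF that(2)] assms
    by (auto simp: lower_def transpose_def I_def)
  have "JM x (JM y f) w = (\<Sum>i\<in>lower x. \<Sum>j\<in>lower y. f (w \<circ> transpose i x \<circ> transpose j y))"
    by (simp add: JM_def)
  also have "\<dots> = (\<Sum>j\<in>lower y. \<Sum>i\<in>lower x. f (w \<circ> transpose i x \<circ> transpose j y))"
    by (rule sum.swap)
  also have "\<dots> = (\<Sum>j\<in>lower y. \<Sum>i\<in>lower x. f (w \<circ> transpose j y \<circ> transpose i x))"
  proof (rule sum.cong)
    fix j assume j: "j \<in> lower y"
    show "(\<Sum>i\<in>lower x. f (w \<circ> transpose i x \<circ> transpose j y))
        = (\<Sum>i\<in>lower x. f (w \<circ> transpose j y \<circ> transpose i x))"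
      using tr[OF _ j] low[OF _ j]
      by (intro sum.reindex_bij_witness[where i = "?s j" and j = "?s j"])
        (simp_all add: comp_assoc)
  qed simp
  finally show "JM x (JM y f) w = JM y (JM x f) w" by (simp add: JM_def)
qed

sublocale jm: commuting_operators I JM
proof
  show "finite I" by (rule finite_I)
  show "JM i (u + v) = JM i u + JM i v" for i u v
    by (simp add: JM_def fun_eq_iff sum.distrib)
  show "JM i (JM j v) = JM j (JM i v)" for i j v
    using JM_comm_less[of i j v] JM_comm_less[of j i v] by (cases i j rule: linorder_cases) auto
qed

lemma mon_add_apply:
  "jm.mon (add_mset x \<beta>) f w = (\<Sum>j\<in>lower x. jm.mon \<beta> f (w \<circ> transpose j x))"
  by (subst jm.mon_add_mset) (rule JM_apply)

lemma mon_outside: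
  assumes "\<And>w. \<not> w permutes \<Omega> \<Longrightarrow> f w = 0" "\<not> w permutes \<Omega>"
  shows "jm.mon \<beta> f w = 0"
  using assms(2)
proof (induction \<beta> arbitrary: w)
  case empty
  then show ?case using assms(1) by simp
next
  case (add x \<beta>)
  have "jm.mon \<beta> f (w \<circ> transpose j x) = 0" if "j \<in> lower x" for j
    using lowerD[OF that] add.prems comp_transpose_permutes_iff[of j x w] by (intro add.IH) blast
  then show ?case unfolding mon_add_apply by (intro sum.neutral) blast
qed

lemma esym_outside:
  assumes "\<And>w. \<not> w permutes \<Omega> \<Longrightarrow> f w = 0" "\<not> w permutes \<Omega>"
  shows "jm.esym S r f w = 0"
  unfolding jm.esym_def sum_fun_apply using mon_outside[OF assms] by (simp add: sum.neutral)

lemma t_on_I_iff: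
  assumes "matching m"
  shows "(\<forall>y\<in>I. m y = t y) \<longleftrightarrow> m = t"
proof
  assume eq: "\<forall>y\<in>I. m y = t y"
  show "m = t"
  proof
    fix a
    consider "a \<notin> \<Omega>" | "a \<in> I" | "t a \<in> I"
      using t_neq[of a] by (fastforce simp: I_def)
    then show "m a = t a"
    proof cases
      case 1
      then show ?thesis using matchingD(1)[OF assms] t_permutes by (simp add: permutes_not_in)
    next
      case 3
      then have "m (t a) = a" using eq by simp
      then show ?thesis using matchingD(2)[OF assms] by metis
    qed (use eq in simp)
  qed
qed simp

lemma card_comps_t_eq: "card (comps t) = card I"
  using size_excess[OF matching_t] excess_empty_iff[OF matching_t] by simp

text \<open>Each matching arises from exactly one choice of transpositions: reading the pairs from
  the largest one downwards, the partner of the upper element \<open>b\<close> determines the transposition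
  in \<^term>\<open>JM b\<close>, which cuts off the component \<open>{b, t b}\<close>.\<close>

lemma esym_prefix:
  assumes "S \<subseteq> I" "\<And>x y. x \<in> S \<Longrightarrow> y \<in> I \<Longrightarrow> y < x \<Longrightarrow> y \<in> S" "w permutes \<Omega>"
  shows "jm.esym S r K_ind w
    = (if (\<forall>y\<in>I - S. mat w y = t y) \<and> card (comps (mat w)) + r = card I then 1 else 0)"
proof -
  have "finite S" using assms(1) finite_I by (rule finite_subset)
  then show ?thesis using assms
  \<comment> \<open>\<open>S\<close> is an initial segment of \<open>I\<close>, so the condition on
    \<open>I - S\<close> says that all pairs above \<open>S\<close> are already base pairs. Removing
    the largest index \<open>b\<close> extends this region by one pair.\<close>
  proof (induction S arbitrary: r w rule: finite_linorder_max_induct)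
    case empty
    have e: "(\<forall>y\<in>I. mat w y = t y) \<longleftrightarrow> w \<in> K"
      using t_on_I_iff[OF matching_mat] mat_eq_t_iff empty.prems(3) by simp
    show ?case
    proof (cases r)
      case 0
      then show ?thesis
        using e mat_eq_t_iff[OF empty.prems(3)] card_comps_t_eq
        by (auto simp: jm.esym_0 K_ind_def)
    next
      case (Suc r')
      then have "{A. A \<subseteq> {} \<and> card A = r} = {}" by auto
      then have "jm.esym {} r K_ind w = 0" by (simp add: jm.esym_def)
      then show ?thesis
        using e mat_eq_t_iff[OF empty.prems(3)] card_comps_t_eq Suc by auto
    qed
  next
    case (insert b A)
    note w = insert.prems(3)
    define m where "m = mat w"
    have m: "matching m" unfolding m_def by (rule matching_mat[OF w])
    have bI: "b \<in> I" and bO: "b \<in> \<Omega>" and tb: "t b < b"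
      using insert.prems(1) I_subset by (auto simp: I_def)
    have bA: "b \<notin> A" using insert.hyps(2) by auto
    have AI: "A \<subseteq> I" using insert.prems(1) by simp
    have down: "y \<in> A" if "x \<in> A" "y \<in> I" "y < x" for x y
    proof -
      have "y \<in> insert b A" using insert.prems(2)[of x y] that by simp
      moreover have "y \<noteq> b" using insert.hyps(2) that by fastforce
      ultimately show ?thesis by simp
    qed
    have IH: "jm.esym A r K_ind w
        = (if (\<forall>y\<in>I - A. mat w y = t y) \<and> card (comps (mat w)) + r = card I then 1 else 0)"
      if "w permutes \<Omega>" for r w
      by (rule insert.IH[OF AI _ that]) (rule down)
    have big: "b < y" if "y \<in> I" "y \<notin> insert b A" for y
      using insert.prems(2)[of b y] that by (metis insertI1 linorder_neqE)
    show ?case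
    proof (cases r)
      case 0
      have fS: "finite (insert b A)" using insert.hyps by simp
      have esym0: "jm.esym (insert b A) 0 K_ind w = jm.esym A 0 K_ind w"
        using insert.hyps by (simp add: jm.esym_0)
      have "m = t" if "card (comps m) = card I"
        using size_excess[OF m] excess_empty_iff[OF m] that by simp
      then show ?thesis
        unfolding 0 esym0 using IH[OF w] unfolding m_def by auto
    next
      case (Suc r')
      have conj: "matching (transpose j b \<circ> m \<circ> transpose j b)" if "j \<in> lower b" for j
        using matching_transpose_conj[OF m] lowerD[OF that] by blast
      have other: "(transpose j b \<circ> m \<circ> transpose j b) y = t y \<longleftrightarrow> m y = t y"
        if j: "j \<in> lower b" and y: "y \<in> I" "y \<notin> insert b A" for j y
      proof -
        have b_y: "b < y" by (rule big[OF y])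
        have ty: "t y \<noteq> j" "t y \<noteq> b"
          using lowerD[OF j] b_y tb by (metis t_t less_asym less_trans)+
        have "(transpose j b \<circ> m \<circ> transpose j b) y = transpose j b (m y)"
          using lowerD[OF j] b_y transpose_apply_other[of j y b] by auto
        also have "\<dots> = t y \<longleftrightarrow> m y = t y"
          using ty by (auto simp: transpose_def)
        finally show ?thesis .
      qed
      \<comment> \<open>The pair of \<open>b\<close> becomes a base pair for one \<open>j\<close>
        only, the current partner of \<open>t b\<close>.\<close>
      have at_b: "(transpose j b \<circ> m \<circ> transpose j b) b = t b \<longleftrightarrow> j = m (t b)" if j: "j \<in> lower b" for j
      proof -
        have "t b \<noteq> j" "t b \<noteq> b" using lowerD[OF j] tb by (metis t_t less_irrefl)+
        then have "(transpose j b \<circ> m \<circ> transpose j b) b = t b \<longleftrightarrow> m j = t b"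
          by (auto simp: transpose_def)
        also have "\<dots> \<longleftrightarrow> j = m (t b)" using matchingD(2)[OF m] by metis
        finally show ?thesis .
      qed
      have val: "jm.esym A r' K_ind (w \<circ> transpose j b)
          = (if j = m (t b) \<and> (\<forall>y\<in>I - insert b A. m y = t y)
                \<and> card (comps (transpose j b \<circ> m \<circ> transpose j b)) + r' = card I then 1 else 0)"
        if j: "j \<in> lower b" for j
      proof -
        have p: "w \<circ> transpose j b permutes \<Omega>"
          using lowerD[OF j] w by (simp add: comp_transpose_permutes_iff)
        have mt: "mat (w \<circ> transpose j b) = transpose j b \<circ> m \<circ> transpose j b"
          unfolding m_def using lowerD[OF j] w by (intro mat_transpose) auto
        have eq: "(\<forall>y\<in>I - A. (transpose j b \<circ> m \<circ> transpose j b) y = t y) \<longleftrightarrow>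
            j = m (t b) \<and> (\<forall>y\<in>I - insert b A. m y = t y)"
        proof -
          have "I - A = insert b (I - insert b A)" using bI bA by auto
          then have "(\<forall>y\<in>I - A. (transpose j b \<circ> m \<circ> transpose j b) y = t y) \<longleftrightarrow>
              (transpose j b \<circ> m \<circ> transpose j b) b = t b \<and>
              (\<forall>y\<in>I - insert b A. (transpose j b \<circ> m \<circ> transpose j b) y = t y)"
            by (simp only: ball_simps)
          then show ?thesis unfolding at_b[OF j] using other[OF j] by blast
        qed
        show ?thesis unfolding IH[OF p] mt eq conj_assoc ..
      qed
      have step: "jm.esym (insert b A) r K_ind w
          = jm.esym A r K_ind w + (\<Sum>j\<in>lower b. jm.esym A r' K_ind (w \<circ> transpose j b))"
        unfolding Suc jm.esym_insert[OF insert.hyps(1) bA] plus_fun_apply by (subst JM_apply) (rule refl)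
      show ?thesis
      \<comment> \<open>If \<open>b\<close> is already matched with \<open>t b\<close>, only subsets
        without \<open>b\<close> contribute, since the required \<open>j\<close> would be
        \<open>b\<close> itself; otherwise only subsets with \<open>b\<close> can
        contribute.\<close>
      proof (cases "m b = t b")
        case True
        have "m (t b) = b" using True matchingD(2)[OF m] by metis
        then have "m (t b) \<notin> lower b" by (simp add: lower_def)
        then have "(\<Sum>j\<in>lower b. jm.esym A r' K_ind (w \<circ> transpose j b)) = 0"
          by (intro sum.neutral) (auto simp: val)
        moreover have "(\<forall>y\<in>I - A. m y = t y) \<longleftrightarrow> (\<forall>y\<in>I - insert b A. m y = t y)"
          using True by auto
        ultimately show ?thesis
          unfolding step using IH[OF w, of r] unfolding m_def[symmetric] by simp
      next
        case False
        then have first: "jm.esym A r K_ind w = 0"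
          using IH[OF w, of r] bI bA unfolding m_def[symmetric] by auto
        let ?j = "m (t b)"
        show ?thesis
        proof (cases "\<forall>y\<in>I - insert b A. m y = t y")
          case False
          then have "(\<Sum>j\<in>lower b. jm.esym A r' K_ind (w \<circ> transpose j b)) = 0"
            by (intro sum.neutral) (auto simp: val)
          then show ?thesis unfolding step first m_def[symmetric] using False by auto
        next
          case True
          have jO: "?j \<in> \<Omega>" using bO matchingD(4)[OF m] by simp
          have mj: "m ?j = t b" using matchingD(2)[OF m] .
          have jb: "?j \<noteq> b" "?j \<noteq> t b"
            using False matchingD(2)[OF m] matchingD(3)[OF m, of "t b"] bO by (metis, simp)
          have tjb: "t ?j \<noteq> b" using jb(2) by (metis t_t)
          have "?j < b \<and> t ?j < b"
          \<comment> \<open>Otherwise the base pair of \<open>?j\<close> lies above that of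
            \<open>b\<close>, where \<open>m\<close> agrees with \<open>t\<close>; then
            \<open>m ?j = t ?j\<close>, although \<open>m ?j = t b\<close> and \<open>?j\<close>
            differs from \<open>b\<close>.\<close>
          proof (rule ccontr)
            assume n: "\<not> (?j < b \<and> t ?j < b)"
            obtain u where u: "u \<in> I" "u = ?j \<or> u = t ?j" "b < u"
            proof (cases "t ?j < ?j")
              case True
              then show ?thesis using that[of ?j] n jO jb by (auto simp: I_def)
            next
              case False
              then have "?j < t ?j" using t_neq[OF jO] by simp
              then show ?thesis using that[of "t ?j"] n jO tjb by (auto simp: I_def)
            qed
            then have "u \<notin> insert b A" using insert.hyps(2) by auto
            then have "m u = t u" using True u(1) by blast
            then have "m ?j = t ?j"
              using u(2) matchingD(2)[OF m] by (metis t_t)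
            then show False using mj jb by simp
          qed
          then have jl: "?j \<in> lower b" using jO bI by (simp add: lower_def)
          let ?m' = "transpose ?j b \<circ> m \<circ> transpose ?j b"
          have m': "matching ?m'" by (rule conj[OF jl])
          have m'b: "?m' b = t b" using at_b[OF jl] by simp
          then have "?m' (t b) = b" using matchingD(2)[OF m'] by metis
          then have "component ?m' b \<subseteq> {b, t b}" using m'b by (intro comp_minimal) auto
          then have "?j \<notin> component ?m' b" using jb by blast
          then have n: "b \<notin> component ?m' ?j" using comp_eq_iff[OF m'] by metis
          have D: "component m ?j \<in> comps m" using jO by (rule comp_in_comps)
          have "t (m ?j) \<in> component m ?j"
            using comps_closed[OF m D] self_in_comp by blast
          then have "b \<in> component m ?j" unfolding mj by simp
          then have cc: "card (comps ?m') = card (comps m) + 1"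
            using comps_transpose_conj(3)[OF m jO bO refl _ n] by blast
          have "(\<Sum>j\<in>lower b. jm.esym A r' K_ind (w \<circ> transpose j b))
              = (\<Sum>j\<in>lower b. if j = ?j then if card (comps m) + r = card I then 1 else 0 else 0)"
            using True cc Suc by (intro sum.cong) (auto simp: val)
          also have "\<dots> = (if card (comps m) + r = card I then 1 else 0)"
            using jl finite_lower by simp
          finally show ?thesis unfolding step first m_def[symmetric] using True by simp
        qed
      qed
    qed
  qed
qed

lemma esym_K_ind:
  assumes "w permutes \<Omega>"
  shows "jm.esym I r K_ind w = (if card (comps (mat w)) + r = card I then 1 else 0)"
  using esym_prefix[of I w r] assms by simp

section \<open>Triangularity\<close>

lemma size_excess_conj_le:
  assumes w: "w permutes \<Omega>" and j: "j \<in> \<Omega>" "x \<in> \<Omega>"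
  shows "size (excess (mat w)) \<le> size (excess (mat (w \<circ> transpose j x))) + 1"
    and "size (excess (mat w)) = size (excess (mat (w \<circ> transpose j x))) + 1 \<Longrightarrow>
      card (comps (mat (w \<circ> transpose j x))) = card (comps (mat w)) + 1"
proof -
  have p: "w \<circ> transpose j x permutes \<Omega>" using w j by (simp add: comp_transpose_permutes_iff)
  note s = size_excess[OF matching_mat[OF w]] size_excess[OF matching_mat[OF p]]
  have "card (comps (mat (w \<circ> transpose j x))) \<le> card (comps (mat w)) + 1"
    using comps_transpose_conj(1)[OF matching_mat[OF w] j mat_transpose[OF w j]] .
  then show "size (excess (mat w)) \<le> size (excess (mat (w \<circ> transpose j x))) + 1"
    using s by linarith
  assume "size (excess (mat w)) = size (excess (mat (w \<circ> transpose j x))) + 1"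
  then show "card (comps (mat (w \<circ> transpose j x))) = card (comps (mat w)) + 1"
    using s by linarith
qed

text \<open>A nonzero value comes from a chain of \<open>size \<beta>\<close> conjugations leading
  back to \<open>t\<close>. Each of them changes the size of the excess by at most one in the
  relevant direction, so equality forces every step to merge, and \<open>compatible_step\<close>
  applies along the whole chain.\<close>

lemma mon_nonzero:
  assumes "w permutes \<Omega>" "jm.mon \<beta> K_ind w \<noteq> 0"
  shows "size (excess (mat w)) \<le> size \<beta> \<and>
    (size (excess (mat w)) = size \<beta> \<longrightarrow> compatible \<beta> (mat w))"
  using assms
proof (induction \<beta> arbitrary: w)
  case empty
  then have "mat w = t" using mat_eq_t_iff[of w] by (simp add: K_ind_def split: if_splits)
  then show ?case using excess_empty_iff[OF matching_t] compatible_empty by simp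
next
  case (add x \<beta>)
  have "(\<Sum>j\<in>lower x. jm.mon \<beta> K_ind (w \<circ> transpose j x)) \<noteq> 0"
    using add.prems(2) unfolding mon_add_apply .
  then obtain j where j: "j \<in> lower x" "jm.mon \<beta> K_ind (w \<circ> transpose j x) \<noteq> 0"
    by (meson sum.neutral)
  note jx = lowerD[OF j(1)]
  then have jO: "j \<in> \<Omega>" "x \<in> \<Omega>" by auto
  have p: "w \<circ> transpose j x permutes \<Omega>" using add.prems(1) jx by (simp add: comp_transpose_permutes_iff)
  have IH: "size (excess (mat (w \<circ> transpose j x))) \<le> size \<beta> \<and>
      (size (excess (mat (w \<circ> transpose j x))) = size \<beta> \<longrightarrow> compatible \<beta> (mat (w \<circ> transpose j x)))"
    by (rule add.IH[OF p j(2)])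
  note s = size_excess_conj_le[OF add.prems(1) jO]
  have "compatible (add_mset x \<beta>) (mat w)" if "size (excess (mat w)) = size \<beta> + 1"
  proof -
    have "size (excess (mat w)) = size (excess (mat (w \<circ> transpose j x))) + 1"
      using that IH s(1) by linarith
    note c = s(2)[OF this]
    note cm = comps_transpose_conj[OF matching_mat[OF add.prems(1)] jO mat_transpose[OF add.prems(1) jO]]
    note n = cm(2)[OF c]
    have "compatible \<beta> (mat (w \<circ> transpose j x))"
      using IH s(1) that by simp
    then show ?thesis
      using jx n cm(3) by (intro compatible_step[OF matching_mat[OF p]]) auto
  qed
  then show ?case using IH s(1) by auto
qed

text \<open>Each sum over \<open>j\<close> has exactly one nonzero term: \<open>excess_step\<close>
  provides it for \<open>j = t (m x)\<close>, and \<open>excess_step_unique\<close> excludes all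
  others.\<close>

lemma mon_excess:
  assumes "w permutes \<Omega>" "excess (mat w) = \<beta>"
  shows "jm.mon \<beta> K_ind w = 1"
  using assms
proof (induction \<beta> arbitrary: w)
  case empty
  then show ?case
    using excess_empty_iff[OF matching_mat] mat_eq_t_iff by (simp add: K_ind_def)
next
  case (add x \<beta>)
  note w = add.prems(1)
  define m where "m = mat w"
  have m: "matching m" unfolding m_def by (rule matching_mat[OF w])
  have ex: "excess m = add_mset x \<beta>" using add.prems(2) by (simp add: m_def)
  then have xe: "x \<in># excess m" by simp
  then have xI: "x \<in> I" using set_excess_subset[OF m] by blast
  then have xO: "x \<in> \<Omega>" using I_subset by blast
  let ?j = "t (m x)"
  note st = excess_step[OF m xe]
  have jl: "?j \<in> lower x" using st(1-3) xI by (simp add: lower_def)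
  have "jm.mon \<beta> K_ind (w \<circ> transpose j x) = (if j = ?j then 1 else 0)" if j: "j \<in> lower x" for j
  proof -
    have jO: "j \<in> \<Omega>" using lowerD[OF j] by simp
    have p: "w \<circ> transpose j x permutes \<Omega>" using w jO xO by (simp add: comp_transpose_permutes_iff)
    note mt = mat_transpose[OF w jO xO]
    show ?thesis
    proof (cases "j = ?j")
      case True
      have "excess (mat (w \<circ> transpose j x)) = \<beta>"
        using st(4) ex mt True unfolding m_def by simp
      then have "jm.mon \<beta> K_ind (w \<circ> transpose j x) = 1" by (rule add.IH[OF p])
      then show ?thesis unfolding if_P[OF True] .
    next
      case False
      have "jm.mon \<beta> K_ind (w \<circ> transpose j x) = 0"
      proof (rule ccontr)
        assume "jm.mon \<beta> K_ind (w \<circ> transpose j x) \<noteq> 0"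
        note nz = mon_nonzero[OF p this]
        note s = size_excess_conj_le[OF w jO xO]
        have sz: "size (excess (mat w)) = size \<beta> + 1" using ex by (simp add: m_def)
        then have "size (excess (mat w)) = size (excess (mat (w \<circ> transpose j x))) + 1"
          using nz s(1) by linarith
        note c = s(2)[OF this]
        have "compatible \<beta> (mat (w \<circ> transpose j x))" using nz s(1) sz by simp
        moreover note comps_transpose_conj(2)[OF matching_mat[OF w] jO xO mt c]
        ultimately have "j = ?j"
          using excess_step_unique[OF m jO xO mt[folded m_def]] ex unfolding m_def by blast
        then show False using False by simp
      qed
      then show ?thesis using False by simp
    qed
  qed
  then have "jm.mon (add_mset x \<beta>) K_ind w = (\<Sum>j\<in>lower x. if j = ?j then 1 else 0)"
    unfolding mon_add_apply by (intro sum.cong refl)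
  then show ?case using jl finite_lower by simp
qed

text \<open>The lexicographic order on degree and number of distinct elements, packed into one
  number. The factor \<open>card I + 1\<close> exceeds the second coordinate, so division recovers
  the first.\<close>

definition level :: "('a \<Rightarrow> 'a) \<Rightarrow> nat" where
  "level w = size (excess (mat w)) * (card I + 1) + card (set_mset (excess (mat w)))"

text \<open>At equal level a contributing \<beta> must coincide with \<open>excess (mat w)\<close>,
  so at most one summand survives, and \<open>mon_excess\<close> gives it the value 1.\<close>

lemma msym_triangular:
  assumes w: "w permutes \<Omega>" and w0: "w0 permutes \<Omega>"
  defines "v \<equiv> jm.msym (mult_type (excess (mat w0))) K_ind"
  shows "v w \<noteq> 0 \<Longrightarrow> level w \<le> level w0"
    and "level w = level w0 \<Longrightarrow>
      v w = (if mult_type (excess (mat w)) = mult_type (excess (mat w0)) then 1 else 0)"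
proof -
  let ?a = "excess (mat w)" and ?b = "excess (mat w0)"
  note m = matching_mat[OF w] matching_mat[OF w0]
  have v: "v w = (\<Sum>\<beta>\<in>typed_multisets I (mult_type ?b). jm.mon \<beta> K_ind w)"
    by (simp add: v_def jm.msym_def sum_fun_apply)
  have le: "card (set_mset \<beta>) < card I + 1" if "set_mset \<beta> \<subseteq> I" for \<beta>
    using card_mono[OF finite_I that] by simp
  note ca = le[OF set_excess_subset[OF m(1)]] le[OF set_excess_subset[OF m(2)]]
  have \<beta>: "size ?a \<le> size ?b \<and> (size ?a = size ?b \<longrightarrow> card (set_mset ?a) \<le> card (set_mset ?b) \<and>
        (card (set_mset ?a) = card (set_mset ?b) \<longrightarrow> \<beta> = ?a))"
    if b: "\<beta> \<in> typed_multisets I (mult_type ?b)" and nz: "jm.mon \<beta> K_ind w \<noteq> 0" for \<beta>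
  proof -
    have sub: "set_mset \<beta> \<subseteq> I" and ty: "mult_type \<beta> = mult_type ?b"
      using b by (auto simp: typed_multisets_def)
    have sz: "size \<beta> = size ?b" "card (set_mset \<beta>) = card (set_mset ?b)"
      using mult_type_eq_size[OF ty] mult_type_eq_card[OF ty] by auto
    note n = mon_nonzero[OF w nz]
    show ?thesis
    proof (intro conjI impI)
      show "size ?a \<le> size ?b" using n sz by simp
      assume "size ?a = size ?b"
      then have c: "compatible \<beta> (mat w)" using n sz by metis
      then show "card (set_mset ?a) \<le> card (set_mset ?b)"
        using compatible_card_le[OF m(1) c] sz(2) by (metis card_mono finite_set_mset)
      assume "card (set_mset ?a) = card (set_mset ?b)"
      then show "\<beta> = ?a"
        using compatible_eq_excess[OF m(1) c] sub I_subset sz(2) by auto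
    qed
  qed
  have lev: "level w < level w0" if "size ?a < size ?b"
  proof -
    have "size ?a * (card I + 1) + card (set_mset ?a) < (size ?a + 1) * (card I + 1)"
      using ca(1) by simp
    also have "\<dots> \<le> size ?b * (card I + 1)"
      using that by (intro mult_right_mono) auto
    finally show ?thesis by (simp add: level_def)
  qed
  show "level w \<le> level w0" if nz: "v w \<noteq> 0"
  proof -
    obtain \<beta> where b: "\<beta> \<in> typed_multisets I (mult_type ?b)" "jm.mon \<beta> K_ind w \<noteq> 0"
      using nz unfolding v by (meson sum.neutral)
    from \<beta>[OF b] have "size ?a < size ?b \<or> size ?a = size ?b \<and> card (set_mset ?a) \<le> card (set_mset ?b)"
      by linarith
    then show ?thesis
    proof
      assume "size ?a < size ?b"
      then show ?thesis using lev by simp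
    qed (simp add: level_def)
  qed
  show "v w = (if mult_type ?a = mult_type ?b then 1 else 0)" if eq: "level w = level w0"
  proof -
    have "size ?a = level w div (card I + 1)" "size ?b = level w0 div (card I + 1)"
      unfolding level_def using ca by (simp_all del: add_Suc_right add: div_mult_self3)
    then have s: "size ?a = size ?b" using eq by simp
    then have c: "card (set_mset ?a) = card (set_mset ?b)" using eq by (simp add: level_def)
    have "v w = (\<Sum>\<beta>\<in>typed_multisets I (mult_type ?b). if \<beta> = ?a then 1 else 0)"
      unfolding v
    proof (rule sum.cong)
      fix \<beta> assume b: "\<beta> \<in> typed_multisets I (mult_type ?b)"
      show "jm.mon \<beta> K_ind w = (if \<beta> = ?a then 1 else 0)"
      proof (cases "\<beta> = ?a")
        case True
        then show ?thesis using mon_excess[OF w refl] by simp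
      next
        case False
        then have "jm.mon \<beta> K_ind w = 0" using \<beta>[OF b] s c by blast
        then show ?thesis using False by simp
      qed
    qed simp
    also have "\<dots> = (if ?a \<in> typed_multisets I (mult_type ?b) then 1 else 0)"
      using finite_typed_multisets[OF finite_I] by simp
    finally show ?thesis using set_excess_subset[OF m(1)] by (simp add: typed_multisets_def)
  qed
qed

section \<open>Generation\<close>

text \<open>A permutation \<open>g\<close> in \<open>K\<close> that carries \<open>mat w\<close> to
  \<open>mat w0\<close> serves as the right factor. The left factor w g^(-1) w0^(-1) commutes with
  \<open>t\<close> because w g^(-1) and \<open>w0\<close> pull \<open>t\<close> back to the same
  matching.\<close>

lemma double_coset:
  assumes w: "w permutes \<Omega>" and w0: "w0 permutes \<Omega>"
    and type: "mult_type (excess (mat w)) = mult_type (excess (mat w0))"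
  shows "\<exists>k\<in>K. \<exists>k'\<in>K. w = k \<circ> w0 \<circ> k'"
proof -
  obtain g where g: "g permutes \<Omega>" "g \<circ> t = t \<circ> g" "g \<circ> mat w = mat w0 \<circ> g"
    using matching_conjugate[OF matching_mat[OF w] matching_mat[OF w0] type] by blast
  let ?k = "w \<circ> Hilbert_Choice.inv g \<circ> Hilbert_Choice.inv w0"
  have perm: "?k permutes \<Omega>"
    using w w0 g(1) by (intro permutes_compose permutes_inv)
  have ginv: "Hilbert_Choice.inv g (mat w0 z) = mat w (Hilbert_Choice.inv g z)" for z
    using g(3) permutes_inverses[OF g(1)] by (metis comp_apply)
  have "?k (t z) = t (?k z)" for z
  proof -
    have "Hilbert_Choice.inv w0 (t z) = mat w0 (Hilbert_Choice.inv w0 z)"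
      by (simp add: mat_def permutes_inverses[OF w0])
    then have "?k (t z) = w (mat w (Hilbert_Choice.inv g (Hilbert_Choice.inv w0 z)))"
      by (simp add: ginv)
    then show ?thesis by (simp add: mat_def permutes_inverses[OF w])
  qed
  then have "?k \<in> K" using perm by (auto simp: K_def fun_eq_iff)
  moreover have "g \<in> K" using g by (simp add: K_def)
  moreover have "w = ?k \<circ> w0 \<circ> g"
    by (simp add: fun_eq_iff permutes_inverses[OF g(1)] permutes_inverses[OF w0])
  ultimately show ?thesis by blast
qed

definition biinvariant :: "(('a \<Rightarrow> 'a) \<Rightarrow> int) set" where
  "biinvariant = {f. (\<forall>w. \<not> w permutes \<Omega> \<longrightarrow> f w = 0) \<and>
     (\<forall>w k k'. w permutes \<Omega> \<longrightarrow> k \<in> K \<longrightarrow> k' \<in> K \<longrightarrow> f (k \<circ> w \<circ> k') = f w)}"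

text \<open>Elimination runs from the top level downwards and, within a level, over the number of
  permutations where \<open>f\<close> does not vanish. The inclusion of \<open>V\<close> in the
  biinvariant functions keeps each difference biinvariant.\<close>

theorem biinvariant_subset:
  assumes V: "esym_closed I JM V K_ind" and sub: "V \<subseteq> biinvariant"
  shows "biinvariant \<subseteq> V"
proof -
  interpret esym_closed I JM V K_ind by (rule V)
  have scale_nat: "(\<lambda>w. int c * v w) \<in> V" if "v \<in> V" for c v
  proof (induction c)
    case 0
    then show ?case using V_0 by (simp add: zero_fun_def)
  next
    case (Suc c)
    have "(\<lambda>w. int (Suc c) * v w) = v + (\<lambda>w. int c * v w)"
      by (simp add: fun_eq_iff algebra_simps)
    then show ?case using V_add[OF that Suc] by simp
  qed
  have scale: "(\<lambda>w. c * v w) \<in> V" if "v \<in> V" for c v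
  proof (cases c)
    case (nonneg n)
    then show ?thesis using scale_nat[OF that] by simp
  next
    case (neg n)
    have "(\<lambda>w. c * v w) = - (\<lambda>w. int (Suc n) * v w)"
      unfolding neg by (simp add: fun_eq_iff del: of_nat_Suc)
    then show ?thesis using V_uminus[OF scale_nat[OF that]] by metis
  qed
  have "f \<in> V" if "f \<in> biinvariant" "\<And>w. w permutes \<Omega> \<Longrightarrow> f w \<noteq> 0 \<Longrightarrow> level w < N" for N f
    using that
  proof (induction N arbitrary: f)
    case 0
    then have "f = 0" by (auto simp: biinvariant_def fun_eq_iff)
    then show ?case using V_0 by (simp only:)
  next
    case (Suc N)
    define Z where "Z f = {w. w permutes \<Omega> \<and> f w \<noteq> 0 \<and> level w = N}" for f :: "('a \<Rightarrow> 'a) \<Rightarrow> int"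
    have fZ: "finite (Z f)" for f
      by (rule finite_subset[OF _ finite_permutations[OF fin]]) (auto simp: Z_def)
    from Suc.prems show ?case
    proof (induction "card (Z f)" arbitrary: f rule: less_induct)
      case less
      show ?case
      proof (cases "Z f = {}")
        case True
        then show ?thesis
          using less.prems by (intro Suc.IH) (auto simp: Z_def less_Suc_eq)
      next
        case False
        then obtain w0 where w0: "w0 permutes \<Omega>" "f w0 \<noteq> 0" "level w0 = N"
          by (auto simp: Z_def)
        define v where "v = jm.msym (mult_type (excess (mat w0))) K_ind"
        have vV: "v \<in> V"
          unfolding v_def by (rule msym_in_V[OF set_excess_subset[OF matching_mat[OF w0(1)]]])
        note tri = msym_triangular[OF _ w0(1), folded v_def]
        define f' where "f' = (\<lambda>w. f w - f w0 * v w)"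
        have v: "v \<in> biinvariant" using vV sub by blast
        have f': "f' \<in> biinvariant"
          using v less.prems(1) by (simp add: biinvariant_def f'_def)
        have same: "f w = f w0" if w: "w permutes \<Omega>" and ty: "mult_type (excess (mat w)) = mult_type (excess (mat w0))" for w
        proof -
          obtain k k' where "k \<in> K" "k' \<in> K" "w = k \<circ> w0 \<circ> k'"
            using double_coset[OF w w0(1) ty] by blast
          then show ?thesis using less.prems(1) w0(1) by (simp add: biinvariant_def)
        qed
        \<comment> \<open>At this level \<open>v\<close> is the indicator of the type of
          \<open>w0\<close>. Off that type \<open>f'\<close> agrees with \<open>f\<close>, and on it
          \<open>f'\<close> vanishes because \<open>f\<close> is constant there.\<close>
        have Z': "f w \<noteq> 0" if "w \<in> Z f'" for w
        proof -
          have w: "w permutes \<Omega>" "f' w \<noteq> 0" "level w = level w0" using that w0 by (auto simp: Z_def)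
          have "v w = 0"
            using tri(2)[OF w(1,3)] w(2) same[OF w(1)] by (auto simp: f'_def split: if_splits)
          then show ?thesis using w(2) by (simp add: f'_def)
        qed
        have "w0 \<notin> Z f'"
          using tri(2)[OF w0(1) refl] by (simp add: Z_def f'_def)
        moreover have "w0 \<in> Z f" using w0 by (simp add: Z_def)
        moreover have "Z f' \<subseteq> Z f" using Z' by (auto simp: Z_def)
        ultimately have "card (Z f') < card (Z f)"
          by (intro psubset_card_mono fZ) blast
        moreover have "level w < Suc N" if "w permutes \<Omega>" "f' w \<noteq> 0" for w
        proof -
          have "f w \<noteq> 0 \<or> v w \<noteq> 0" using that(2) by (auto simp: f'_def)
          then show ?thesis using less.prems(2)[OF that(1)] tri(1)[OF that(1)] w0(3) by auto
        qed
        ultimately have "f' \<in> V" using f' by (intro less.hyps) auto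
        moreover have "f = f' + (\<lambda>w. f w0 * v w)" by (simp add: fun_eq_iff f'_def)
        ultimately show ?thesis using V_add[OF _ scale[OF vV]] by metis
      qed
    qed
  qed note N = this
  show ?thesis
  proof
    fix f assume f: "f \<in> biinvariant"
    have "finite (level ` {w. w permutes \<Omega>})" using finite_permutations[OF fin] by simp
    then obtain N where "\<forall>w. w permutes \<Omega> \<longrightarrow> level w < N"
      by (auto simp: finite_nat_set_iff_bounded)
    then show "f \<in> V" using N[OF f] by blast
  qed
qed

section \<open>Invariance of the component count under double cosets\<close>

lemma component_conj:
  assumes m: "matching m" and k: "k \<in> K" and a: "a \<in> \<Omega>"
  shows "component m (k a) = k ` component (Hilbert_Choice.inv k \<circ> m \<circ> k) a"
proof
  let ?m = "Hilbert_Choice.inv k \<circ> m \<circ> k"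
  have kp: "k permutes \<Omega>" and kt: "k (t z) = t (k z)" for z
    using k by (auto simp: K_def fun_eq_iff)
  have km: "k (?m z) = m (k z)" for z
    by (simp add: permutes_inverses[OF kp])
  have m': "matching ?m" by (rule matching_conj[OF m kp])
  have ka: "k a \<in> \<Omega>" using kp a by (simp add: permutes_in_image)
  show "component m (k a) \<subseteq> k ` component ?m a"
  proof (rule comp_minimal)
    show "k a \<in> k ` component ?m a" by (simp add: self_in_comp)
    fix b assume "b \<in> k ` component ?m a"
    then obtain z where z: "b = k z" "z \<in> component ?m a" by blast
    show "t b \<in> k ` component ?m a"
      using comps_closed(1)[OF m' comp_in_comps[OF a] z(2)] unfolding z(1) kt[symmetric] by (rule imageI)
    show "m b \<in> k ` component ?m a"
      using comps_closed(2)[OF m' comp_in_comps[OF a] z(2)] unfolding z(1) km[symmetric] by (rule imageI)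
  qed
  have "component ?m a \<subseteq> k -` component m (k a)"
  proof (rule comp_minimal)
    show "a \<in> k -` component m (k a)" by (simp add: self_in_comp)
    fix b assume "b \<in> k -` component m (k a)"
    then have b: "k b \<in> component m (k a)" by simp
    show "t b \<in> k -` component m (k a)"
      using comps_closed(1)[OF m comp_in_comps[OF ka] b] by (simp add: kt)
    show "?m b \<in> k -` component m (k a)"
      using comps_closed(2)[OF m comp_in_comps[OF ka] b] km[of b] by simp
  qed
  then show "k ` component ?m a \<subseteq> component m (k a)" by blast
qed

lemma card_comps_conj:
  assumes m: "matching m" and k: "k \<in> K"
  shows "card (comps (Hilbert_Choice.inv k \<circ> m \<circ> k)) = card (comps m)"
proof -
  have kp: "k permutes \<Omega>" using k by (simp add: K_def)
  have "comps m = component m ` (k ` \<Omega>)"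
    unfolding comps_eq permutes_image[OF kp] ..
  also have "\<dots> = (`) k ` comps (Hilbert_Choice.inv k \<circ> m \<circ> k)"
    unfolding comps_eq image_image using component_conj[OF m k] by (intro image_cong) auto
  finally show ?thesis
    using permutes_inj[OF kp] by (simp add: card_image inj_on_def inj_image_eq_iff)
qed

lemma mat_K_left:
  assumes "k \<in> K" "w permutes \<Omega>"
  shows "mat (k \<circ> w) = mat w"
proof -
  have kp: "k permutes \<Omega>" using assms(1) by (simp add: K_def)
  have "mat k = t" using assms(1) mat_eq_t_iff[OF kp] by simp
  then show ?thesis using mat_comp[OF kp assms(2)] by (simp add: mat_def)
qed

lemma card_comps_mat_biinvariant:
  assumes "k \<in> K" "k' \<in> K" "w permutes \<Omega>"
  shows "card (comps (mat (k \<circ> w \<circ> k'))) = card (comps (mat w))"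
proof -
  have p: "k permutes \<Omega>" "k' permutes \<Omega>" using assms by (auto simp: K_def)
  have kw: "k \<circ> w permutes \<Omega>" using p assms(3) by (intro permutes_compose)
  show ?thesis
    using mat_comp[OF kw p(2)] mat_K_left[OF assms(1,3)]
      card_comps_conj[OF matching_mat[OF assms(3)] assms(2)] by simp
qed

lemma card_comps_pos: "\<Omega> \<noteq> {} \<Longrightarrow> card (comps m) > 0"
  using finite_comps by (simp add: card_gt_0_iff comps_eq fin)

section \<open>Convolution and the Jucys-Murphy operators\<close>

lemma K_ind_outside: "\<not> w permutes \<Omega> \<Longrightarrow> K_ind w = 0"
  by (simp add: K_ind_def K_def)

text \<open>Convolution before division by the order of the subgroup, so that linearity and changes
  of variable need no divisibility argument.\<close>

definition conv :: "(('a \<Rightarrow> 'a) \<Rightarrow> int) \<Rightarrow> (('a \<Rightarrow> 'a) \<Rightarrow> int) \<Rightarrow> ('a \<Rightarrow> 'a) \<Rightarrow> int" where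
  "conv f g x = (\<Sum>y | y permutes \<Omega>. f (x \<circ> Hilbert_Choice.inv y) * g y)"

lemma conv_sum: "conv f (\<Sum>i\<in>X. g i) = (\<Sum>i\<in>X. conv f (g i))"
  unfolding fun_eq_iff conv_def sum_fun_apply
  by (simp add: sum_distrib_left sum.swap[of _ X])

text \<open>Translating the summation variable by the transposition moves the translation from the
  second factor to the argument of the convolution.\<close>

lemma conv_JM: "conv f (JM x g) = JM x (conv f g)"
proof
  fix w
  let ?P = "{y. y permutes \<Omega>}"
  have "conv f (JM x g) w = (\<Sum>j\<in>lower x. \<Sum>y\<in>?P. f (w \<circ> Hilbert_Choice.inv y) * g (y \<circ> transpose j x))"
    unfolding conv_def JM_apply sum_distrib_left by (rule sum.swap)
  also have "\<dots> = (\<Sum>j\<in>lower x. \<Sum>z\<in>?P. f (w \<circ> transpose j x \<circ> Hilbert_Choice.inv z) * g z)"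
  proof (rule sum.cong)
    fix j assume "j \<in> lower x"
    then have tau: "transpose j x permutes \<Omega>" using lowerD by (intro permutes_swap_id) auto
    show "(\<Sum>y\<in>?P. f (w \<circ> Hilbert_Choice.inv y) * g (y \<circ> transpose j x))
        = (\<Sum>z\<in>?P. f (w \<circ> transpose j x \<circ> Hilbert_Choice.inv z) * g z)"
    proof (rule sum.reindex_bij_witness[where i = "\<lambda>z. z \<circ> transpose j x" and j = "\<lambda>y. y \<circ> transpose j x"])
      fix y assume "y \<in> ?P"
      then have y: "y permutes \<Omega>" by simp
      show "y \<circ> transpose j x \<circ> transpose j x = y" by (simp add: comp_assoc)
      then show "y \<circ> transpose j x \<circ> transpose j x = y" .
      show "y \<circ> transpose j x \<in> ?P" using permutes_compose[OF tau y] by simp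
      then show "y \<circ> transpose j x \<in> ?P" .
      have "Hilbert_Choice.inv (y \<circ> transpose j x) = transpose j x \<circ> Hilbert_Choice.inv y"
        using o_inv_distrib[OF permutes_bij[OF y] permutes_bij[OF tau]] by simp
      then have "w \<circ> transpose j x \<circ> Hilbert_Choice.inv (y \<circ> transpose j x) = w \<circ> Hilbert_Choice.inv y"
        by (simp add: fun_eq_iff)
      then show "f (w \<circ> transpose j x \<circ> Hilbert_Choice.inv (y \<circ> transpose j x)) * g (y \<circ> transpose j x)
          = f (w \<circ> Hilbert_Choice.inv y) * g (y \<circ> transpose j x)"
        by (simp only:)
    qed
  qed simp
  also have "\<dots> = JM x (conv f g) w" unfolding JM_apply conv_def ..
  finally show "conv f (JM x g) w = JM x (conv f g) w" .
qed

lemma conv_esym: "conv f (jm.esym S r g) = jm.esym S r (conv f g)"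
proof -
  have "conv f (jm.mon \<alpha> g) = jm.mon \<alpha> (conv f g)" for \<alpha>
    by (induction \<alpha>) (simp_all add: conv_JM)
  then show ?thesis by (simp add: jm.esym_def conv_sum)
qed

lemma conv_K_ind:
  assumes "f \<in> biinvariant"
  shows "conv f K_ind = (\<lambda>x. int (card K) * f x)"
proof
  fix x
  have KP: "K \<subseteq> {y. y permutes \<Omega>}" by (auto simp: K_def)
  have "conv f K_ind x = (\<Sum>y\<in>K. f (x \<circ> Hilbert_Choice.inv y))"
    unfolding conv_def using KP finite_permutations[OF fin]
    by (intro sum.mono_neutral_cong_right) (auto simp: K_ind_def)
  also have "\<dots> = (\<Sum>y\<in>K. f x)"
  proof (rule sum.cong)
    fix y assume y: "y \<in> K"
    have yp: "y permutes \<Omega>" using y KP by auto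
    show "f (x \<circ> Hilbert_Choice.inv y) = f x"
    proof (cases "x permutes \<Omega>")
      case True
      have "id \<in> K" by (simp add: K_def permutes_id)
      then have "f (id \<circ> (x \<circ> Hilbert_Choice.inv y) \<circ> y) = f (x \<circ> Hilbert_Choice.inv y)"
        using assms y permutes_compose[OF permutes_inv[OF yp] True] unfolding biinvariant_def by blast
      moreover have "id \<circ> (x \<circ> Hilbert_Choice.inv y) \<circ> y = x"
        by (simp add: comp_assoc permutes_inv_o(2)[OF yp])
      ultimately show ?thesis by (simp only:)
    next
      case False
      have "\<not> x \<circ> Hilbert_Choice.inv y permutes \<Omega>"
      proof
        assume "x \<circ> Hilbert_Choice.inv y permutes \<Omega>"
        from permutes_compose[OF yp this] have "x permutes \<Omega>"
          by (simp add: comp_assoc permutes_inv_o(2)[OF yp])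
        then show False using False by simp
      qed
      then show ?thesis using False assms by (simp add: biinvariant_def)
    qed
  qed simp
  finally show "conv f K_ind x = int (card K) * f x" by simp
qed

lemma esym_scale: "jm.esym S r (\<lambda>x. c * f x) = (\<lambda>x. c * jm.esym S r f x)"
proof -
  have JM: "JM y (\<lambda>x. c * g x) = (\<lambda>x. c * JM y g x)" for y g
    by (simp add: JM_def sum_distrib_left)
  have "jm.mon \<alpha> (\<lambda>x. c * f x) = (\<lambda>x. c * jm.mon \<alpha> f x)" for \<alpha>
  proof (induction \<alpha>)
    case (add y \<alpha>)
    show ?case unfolding jm.mon_add_mset add by (rule JM)
  qed simp
  then show ?thesis
    by (simp add: jm.esym_def fun_eq_iff sum_fun_apply sum_distrib_left)
qed

lemma conv_esym_K_ind:
  assumes "f \<in> biinvariant"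
  shows "conv f (jm.esym S r K_ind) x = int (card K) * jm.esym S r f x"
  unfolding conv_esym conv_K_ind[OF assms] esym_scale ..

end

section \<open>Cycles of the graph\<close>

lemma pair_involution_apply:
  "pair_involution n x = (if x \<in> {1..2 * n} then if odd x then x + 1 else x - 1 else x)"
proof (induction n arbitrary: x)
  case (Suc n)
  show ?case
    unfolding pair_involution.simps comp_apply Suc
    by (auto simp: transpose_def)
qed simp

lemma paired_set_pair_involution: "paired_set {1..2 * n} (pair_involution n)"
proof
  show "pair_involution n permutes {1..2 * n}" by (rule pair_involution_permutes)
  show "pair_involution n (pair_involution n a) = a" for a
    by (auto simp: pair_involution_apply elim!: oddE evenE) presburger
  show "pair_involution n a \<noteq> a" if "a \<in> {1..2 * n}" for a
    using that by (auto simp: pair_involution_apply)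
qed simp

locale pairs = paired_set \<Omega> t for \<Omega> :: "nat set" and t :: "nat \<Rightarrow> nat" +
  fixes n :: nat
  assumes Omega: "\<Omega> = {1..2 * n}" and t_eq: "t = pair_involution n"

context pairs
begin

text \<open>The index k of the base pair \<open>{2 * k - 1, 2 * k}\<close> that contains
  \<open>a\<close>.\<close>

abbreviation pr :: "nat \<Rightarrow> nat" where
  "pr a \<equiv> (a + 1) div 2"

lemma pr_pair:
  assumes "a \<in> \<Omega>"
  shows "pr a \<in> {1..n}" "{2 * pr a - 1, 2 * pr a} = {a, t a}"
proof -
  have a: "1 \<le> a" "a \<le> 2 * n" using assms by (auto simp: Omega)
  then show "pr a \<in> {1..n}" by auto
  show "{2 * pr a - 1, 2 * pr a} = {a, t a}"
  proof (cases "even a")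
    case True
    then have "2 * pr a = a" "t a = a - 1" using a by (auto simp: t_eq pair_involution_apply)
    then show ?thesis by auto
  next
    case False
    then have "2 * pr a = a + 1" "t a = a + 1" using a by (auto simp: t_eq pair_involution_apply)
    then show ?thesis by auto
  qed
qed

lemma pr_eq:
  assumes "k \<in> {1..n}" "a \<in> {2 * k - 1, 2 * k}"
  shows "a \<in> \<Omega>" "k = pr a"
  using assms by (auto simp: Omega)

context
  fixes w assumes w: "w permutes \<Omega>"
begin

lemma ends_Inl:
  assumes "a \<in> \<Omega>"
  shows "ends (Gamma_graph n w) (Inl (pr a)) = {a, t a}"
  using pr_pair(2)[OF assms] by (simp add: Gamma_graph_def)

lemma ends_Inr:
  assumes "a \<in> \<Omega>"
  shows "ends (Gamma_graph n w) (Inr (pr (w a))) = {a, mat w a}"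
proof -
  have wa: "w a \<in> \<Omega>" using assms permutes_in_image[OF w] by blast
  have "ends (Gamma_graph n w) (Inr (pr (w a))) = Hilbert_Choice.inv w ` {2 * pr (w a) - 1, 2 * pr (w a)}"
    by (simp add: Gamma_graph_def)
  also have "\<dots> = {a, mat w a}"
    unfolding pr_pair(2)[OF wa] by (simp add: mat_def permutes_inverses[OF w])
  finally show ?thesis .
qed

text \<open>Each vertex lies on exactly one edge of either kind. The two differ as elements of the
  sum type even when they are parallel, so the degree is 2 also at a double edge.\<close>

lemma edge_at_iff:
  "e \<in> edges (Gamma_graph n w) \<and> a \<in> ends (Gamma_graph n w) e \<longleftrightarrow>
    a \<in> \<Omega> \<and> (e = Inl (pr a) \<or> e = Inr (pr (w a)))"
proof
  assume e: "e \<in> edges (Gamma_graph n w) \<and> a \<in> ends (Gamma_graph n w) e"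
  then consider k where "e = Inl k" "k \<in> {1..n}" "a \<in> {2 * k - 1, 2 * k}"
    | k where "e = Inr k" "k \<in> {1..n}" "a \<in> Hilbert_Choice.inv w ` {2 * k - 1, 2 * k}"
    by (auto simp: Gamma_graph_def)
  then show "a \<in> \<Omega> \<and> (e = Inl (pr a) \<or> e = Inr (pr (w a)))"
  proof cases
    case 1
    then show ?thesis using pr_eq by blast
  next
    case (2 k)
    then have wa: "w a \<in> {2 * k - 1, 2 * k}" using permutes_inverses(1)[OF w] by auto
    then have "w a \<in> \<Omega>" "k = pr (w a)" using pr_eq[OF 2(2)] by auto
    then show ?thesis using 2(1) permutes_in_image[OF w] by blast
  qed
next
  assume a: "a \<in> \<Omega> \<and> (e = Inl (pr a) \<or> e = Inr (pr (w a)))"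
  then have "w a \<in> \<Omega>" using permutes_in_image[OF w] by blast
  then have "e \<in> edges (Gamma_graph n w)"
    using a pr_pair(1) by (auto simp: Gamma_graph_def)
  moreover have "a \<in> ends (Gamma_graph n w) e" using a ends_Inl ends_Inr by auto
  ultimately show "e \<in> edges (Gamma_graph n w) \<and> a \<in> ends (Gamma_graph n w) e" by simp
qed

text \<open>The graph is 2-regular, so a cycle contains all edges at each of its vertices and is the
  full edge set of a connected component. The bijection sends a component to the edges that meet
  it.\<close>

lemma cycle_count_eq: "cycle_count n w = card (comps (mat w))"
proof -
  let ?X = "Gamma_graph n w" and ?m = "mat w"
  let ?\<Phi> = "\<lambda>D. {e \<in> edges ?X. ends ?X e \<inter> D \<noteq> {}}"
  have m: "matching ?m" by (rule matching_mat[OF w])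
  have ends_e: "\<exists>b. ends ?X e = {a, b} \<and> (b = t a \<or> b = ?m a)"
    if "e \<in> edges ?X" "a \<in> ends ?X e" for e a
    using edge_at_iff[of e a] that ends_Inl ends_Inr by blast
  have Phi: "(\<Union>(ends ?X ` ?\<Phi> D)) = D" if D: "D \<in> comps ?m" for D
  proof
    show "\<Union>(ends ?X ` ?\<Phi> D) \<subseteq> D"
    proof
      fix b assume "b \<in> \<Union>(ends ?X ` ?\<Phi> D)"
      then obtain e a where e: "e \<in> edges ?X" "b \<in> ends ?X e" "a \<in> ends ?X e" "a \<in> D" by auto
      then show "b \<in> D" using ends_e[OF e(1,3)] comps_closed[OF m D e(4)] by auto
    qed
    show "D \<subseteq> \<Union>(ends ?X ` ?\<Phi> D)"
    proof
      fix a assume a: "a \<in> D"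
      then have "a \<in> \<Omega>" using comps_subset[OF m D] by blast
      then have "Inl (pr a) \<in> edges ?X \<and> a \<in> ends ?X (Inl (pr a))" using edge_at_iff by blast
      then show "a \<in> \<Union>(ends ?X ` ?\<Phi> D)" using a by blast
    qed
  qed
  have cyc: "is_cycle ?X (?\<Phi> D)" if D: "D \<in> comps ?m" for D
    unfolding is_cycle_def Phi[OF D]
  proof (intro conjI ballI)
    show "?\<Phi> D \<subseteq> edges ?X" by auto
    show "finite (?\<Phi> D)" by (simp add: Gamma_graph_def)
    show "?\<Phi> D \<noteq> {}" using Phi[OF D] comps_nonempty[OF D] by force
    fix v assume v: "v \<in> D"
    have vO: "v \<in> \<Omega>" using comps_subset[OF m D] v by blast
    have "{e \<in> ?\<Phi> D. v \<in> ends ?X e} = {Inl (pr v), Inr (pr (w v))}"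
      using edge_at_iff[of _ v] v vO by blast
    then show "card {e \<in> ?\<Phi> D. v \<in> ends ?X e} = 2" by simp
  next
    fix u v assume u: "u \<in> D" and v: "v \<in> D"
    let ?R = "{(a, b). \<exists>e\<in>?\<Phi> D. ends ?X e = {a, b}}"
    have "(u, v) \<in> (links ?m)\<^sup>*"
      using comps_closed(3)[OF m D u] v by (auto simp: component_def)
    then have "v \<in> D \<and> (u, v) \<in> ?R\<^sup>*"
    proof induction
      case base
      then show ?case using u by simp
    next
      case (step a b)
      have aD: "a \<in> D" using step by simp
      have aO: "a \<in> \<Omega>" using comps_subset[OF m D] aD by blast
      have e: "Inl (pr a) \<in> ?\<Phi> D" "Inr (pr (w a)) \<in> ?\<Phi> D"
        using edge_at_iff[of _ a] aO aD by blast+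
      have "b = t a \<or> b = ?m a" using step(2) by (auto simp: links_def)
      then have "(a, b) \<in> ?R" "b \<in> D"
        using e ends_Inl[OF aO] ends_Inr[OF aO] comps_closed[OF m D aD] by blast+
      then show ?case using step by (meson rtrancl.rtrancl_into_rtrancl)
    qed
    then show "(u, v) \<in> ?R\<^sup>*" by simp
  qed
  have surj: "F \<in> ?\<Phi> ` comps ?m" if F: "is_cycle ?X F" for F
  proof -
    let ?U = "\<Union>(ends ?X ` F)"
    have FE: "F \<subseteq> edges ?X" using F by (simp add: is_cycle_def)
    \<comment> \<open>Degree 2 within \<open>F\<close>, with only two edges of the graph at
      \<open>a\<close>, forces both into \<open>F\<close>. This makes the vertex set of
      \<open>F\<close> closed under \<open>t\<close> and \<open>mat w\<close>.\<close>
    have both: "Inl (pr a) \<in> F" "Inr (pr (w a)) \<in> F" "a \<in> \<Omega>" if a: "a \<in> ?U" for a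
    proof -
      have sub: "{e \<in> F. a \<in> ends ?X e} \<subseteq> {Inl (pr a), Inr (pr (w a))}"
        using edge_at_iff[of _ a] FE by blast
      have "card {e \<in> F. a \<in> ends ?X e} = 2"
        using F a unfolding is_cycle_def by blast
      then have "{e \<in> F. a \<in> ends ?X e} = {Inl (pr a), Inr (pr (w a))}"
        using sub by (intro card_subset_eq) auto
      then show "Inl (pr a) \<in> F" "Inr (pr (w a)) \<in> F" by blast+
      show "a \<in> \<Omega>" using a FE edge_at_iff by blast
    qed
    obtain e where e: "e \<in> F" using F unfolding is_cycle_def by blast
    have "ends ?X e \<noteq> {}" by (cases e) (auto simp: Gamma_graph_def)
    then obtain v where v: "v \<in> ?U" using e by blast
    let ?D = "component ?m v"
    have vO: "v \<in> \<Omega>" by (rule both(3)[OF v])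
    have D: "?D \<in> comps ?m" using vO by (rule comp_in_comps)
    have "?D \<subseteq> ?U"
    proof (rule comp_minimal[OF v])
      fix b assume b: "b \<in> ?U"
      show "t b \<in> ?U" using both[OF b] ends_Inl[of b] by blast
      show "?m b \<in> ?U" using both[OF b] ends_Inr[of b] by blast
    qed
    moreover have "?U \<subseteq> ?D"
    proof
      fix u assume u: "u \<in> ?U"
      have "(v, u) \<in> {(a, b). \<exists>e\<in>F. ends ?X e = {a, b}}\<^sup>*"
        using F u v unfolding is_cycle_def by blast
      then show "u \<in> ?D"
      proof induction
        case base
        then show ?case by (rule self_in_comp)
      next
        case (step a b)
        then obtain e where e: "e \<in> F" "ends ?X e = {a, b}" by blast
        then obtain b' where "{a, b} = {a, b'}" "b' = t a \<or> b' = ?m a"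
          using ends_e[of e a] FE by auto
        then have "b = t a \<or> b = ?m a \<or> b = a" by (metis doubleton_eq_iff)
        then show ?case using comps_closed[OF m D step(3)] step(3) by auto
      qed
    qed
    ultimately have U: "?U = ?D" by blast
    have "F = ?\<Phi> ?D"
    proof
      show "F \<subseteq> ?\<Phi> ?D"
      proof
        fix e assume e: "e \<in> F"
        have "ends ?X e \<noteq> {}" by (cases e) (auto simp: Gamma_graph_def)
        then show "e \<in> ?\<Phi> ?D" using e FE U by blast
      qed
      show "?\<Phi> ?D \<subseteq> F"
      proof
        fix e assume "e \<in> ?\<Phi> ?D"
        then obtain a where a: "e \<in> edges ?X" "a \<in> ends ?X e" "a \<in> ?U" using U by blast
        then show "e \<in> F" using both[OF a(3)] edge_at_iff[of e a] by blast
      qed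
    qed
    then show ?thesis using D by blast
  qed
  have "{F. is_cycle ?X F} = ?\<Phi> ` comps ?m" using cyc surj by blast
  moreover have "inj_on ?\<Phi> (comps ?m)" using Phi by (metis (no_types, lifting) inj_onI)
  ultimately show ?thesis by (simp add: cycle_count_def card_image)
qed

end

section \<open>Identification with the Hecke ring and its elements\<close>

lemma carrier_iff: "w \<in> carrier (sym_group (2 * n)) \<longleftrightarrow> w permutes \<Omega>"
  by (simp only: sym_group_carrier Omega)

lemma K_eq: "K = hyperoctahedral n"
  unfolding K_def hyperoctahedral_def carrier_iff t_eq[symmetric] ..

lemma biinvariant_eq: "biinvariant = hecke_carrier (sym_group (2 * n)) (hyperoctahedral n)"
  unfolding biinvariant_def hecke_carrier_def K_eq Ball_def carrier_iff sym_group_mult by blast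

lemma card_I: "card I = n"
proof -
  have "\<Omega> \<inter> I = I" using I_subset by blast
  then have "card \<Omega> = 2 * card I" using card_t_closed[of \<Omega>] by simp
  then show ?thesis by (simp add: Omega)
qed

lemma H_elem_biinvariant: "H_elem n i \<in> biinvariant"
  unfolding biinvariant_def
proof (intro CollectI conjI allI impI)
  show "H_elem n i w = 0" if "\<not> w permutes \<Omega>" for w
    using that by (simp add: H_elem_def carrier_iff)
  fix w k k' assume w: "w permutes \<Omega>" and k: "k \<in> K" "k' \<in> K"
  have "k \<circ> w \<circ> k' permutes \<Omega>"
    using w k by (intro permutes_compose) (auto simp: K_def)
  then show "H_elem n i (k \<circ> w \<circ> k') = H_elem n i w"
    using w card_comps_mat_biinvariant[OF k w]
    unfolding H_elem_def carrier_iff by (simp only: cycle_count_eq)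
qed

lemma esym_K_ind_eq:
  assumes "r \<le> n"
  shows "jm.esym I r K_ind = H_elem n (n - r)"
proof
  fix w
  show "jm.esym I r K_ind w = H_elem n (n - r) w"
  proof (cases "w permutes \<Omega>")
    case True
    then show ?thesis
      using esym_K_ind[OF True, of r] assms unfolding H_elem_def carrier_iff cycle_count_eq[OF True] card_I
      by auto
  next
    case False
    then show ?thesis
      using esym_outside[of K_ind w I r, OF K_ind_outside]
      by (simp add: H_elem_def carrier_iff)
  qed
qed

text \<open>In degree r = n the operator e_r corresponds to \<open>H_elem n 0\<close>, which is not
  among the listed generators. It vanishes because a nonempty graph of this kind has a
  cycle.\<close>

lemma H_elem_0:
  assumes "n \<ge> 1"
  shows "H_elem n 0 = (\<lambda>w. 0)"
proof
  fix w
  have "card (comps (mat w)) > 0" using assms by (intro card_comps_pos) (auto simp: Omega)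
  then show "H_elem n 0 w = 0"
    using cycle_count_eq[of w] by (auto simp: H_elem_def carrier_iff)
qed

text \<open>Convolution from the left commutes with e_r, and convolution with the unit multiplies
  \<open>f\<close> by \<open>card K\<close>; the integer division in the Hecke product removes this
  factor exactly.\<close>

lemma hecke_mult_esym:
  assumes f: "f \<in> biinvariant"
  shows "hecke_mult (sym_group (2 * n)) (hyperoctahedral n) f (jm.esym I r K_ind) = jm.esym I r f"
proof
  fix x
  have fz: "f w = 0" if "\<not> w permutes \<Omega>" for w
    using f that by (simp add: biinvariant_def)
  have "finite K" using finite_permutations[OF fin] by (rule finite_subset[rotated]) (auto simp: K_def)
  moreover have "id \<in> K" by (simp add: K_def permutes_id)
  ultimately have K0: "card K > 0" by (auto simp: card_gt_0_iff)
  show "hecke_mult (sym_group (2 * n)) (hyperoctahedral n) f (jm.esym I r K_ind) x = jm.esym I r f x"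
  proof (cases "x permutes \<Omega>")
    case True
    have "(\<Sum>y\<in>carrier (sym_group (2 * n)). f (x \<otimes>\<^bsub>sym_group (2 * n)\<^esub> inv\<^bsub>sym_group (2 * n)\<^esub> y) * jm.esym I r K_ind y)
        = conv f (jm.esym I r K_ind) x"
      unfolding conv_def by (intro sum.cong) (auto simp: carrier_iff sym_group_mult)
    then show ?thesis
      using True K0 unfolding hecke_mult_def carrier_iff K_eq[symmetric] conv_esym_K_ind[OF f]
      by simp
  next
    case False
    then show ?thesis
      using esym_outside[of f x I r, OF fz] by (simp add: hecke_mult_def carrier_iff)
  qed
qed

theorem generate_ring_H_elem:
  assumes "n \<ge> 1"
  shows "generate_ring (hecke_ring (sym_group (2 * n)) (hyperoctahedral n))
           {H_elem n i | i. i \<in> {1..n}}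
         = carrier (hecke_ring (sym_group (2 * n)) (hyperoctahedral n))"
proof -
  let ?R = "hecke_ring (sym_group (2 * n)) (hyperoctahedral n)"
  let ?V = "generate_ring ?R {H_elem n i | i. i \<in> {1..n}}"
  interpret R: ring ?R by (rule ring_hyperoctahedral_hecke_ring)
  have car: "carrier ?R = biinvariant" by (simp add: hecke_ring_def biinvariant_eq)
  have add: "u \<oplus>\<^bsub>?R\<^esub> v = u + v" for u v
    by (simp add: hecke_ring_def fun_eq_iff)
  have sub: "?V \<subseteq> carrier ?R"
    using R.generate_ring_in_carrier[of "{H_elem n i | i. i \<in> {1..n}}"] H_elem_biinvariant
    by (auto simp: car)
  have one: "\<one>\<^bsub>?R\<^esub> = K_ind"
    by (simp add: hecke_ring_def K_ind_def K_eq fun_eq_iff)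
  have zero: "\<zero>\<^bsub>?R\<^esub> = 0"
    by (simp add: hecke_ring_def fun_eq_iff)
  have V: "esym_closed I JM ?V K_ind"
  proof
    show K: "K_ind \<in> ?V" using generate_ring.one[of ?R] by (simp add: one)
    show "u + v \<in> ?V" if "u \<in> ?V" "v \<in> ?V" for u v
      using generate_ring.eng_add[OF that] by (simp add: add)
    show um: "- u \<in> ?V" if "u \<in> ?V" for u
    proof -
      have u: "u \<in> biinvariant" using that sub car by auto
      then have "- u \<in> biinvariant" by (simp add: biinvariant_def)
      then have "\<ominus>\<^bsub>?R\<^esub> u = - u"
        using u by (intro R.minus_equality) (simp_all add: add zero car)
      then show ?thesis using generate_ring.a_inv[OF that] by simp
    qed
    fix r u assume r: "r \<le> card I" and u: "u \<in> ?V"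
    have ub: "u \<in> biinvariant" using u sub car by auto
    have "H_elem n (n - r) \<in> ?V"
    proof (cases "r = n")
      case True
      \<comment> \<open>The element required here is the zero function, reached inside the subring
        as the unit plus its negative.\<close>
      have "K_ind + - K_ind \<in> ?V"
        using generate_ring.eng_add[OF K um[OF K]] by (simp add: add)
      then show ?thesis using H_elem_0[OF assms] True by (simp add: zero_fun_def)
    next
      case False
      then show ?thesis using r card_I by (intro generate_ring.incl) auto
    qed
    then have "u \<otimes>\<^bsub>?R\<^esub> H_elem n (n - r) \<in> ?V" by (rule generate_ring.eng_mult[OF u])
    also have "u \<otimes>\<^bsub>?R\<^esub> H_elem n (n - r) = jm.esym I r u"
      using hecke_mult_esym[OF ub, of r] esym_K_ind_eq[of r] r card_I by (simp add: hecke_ring_def)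
    finally show "jm.esym I r u \<in> ?V" .
  qed
  show ?thesis
    using biinvariant_subset[OF V] sub unfolding car by blast
qed

end

theorem theorem4p9:
  fixes n :: nat
  assumes "n \<ge> 1"
  shows "generate_ring (hecke_ring (sym_group (2 * n)) (hyperoctahedral n))
           {H_elem n i | i. i \<in> {1..n}}
         = carrier (hecke_ring (sym_group (2 * n)) (hyperoctahedral n))"
proof -
  interpret pairs "{1..2 * n}" "pair_involution n" n
    by (intro pairs.intro pairs_axioms.intro paired_set_pair_involution refl)
  show ?thesis by (rule generate_ring_H_elem[OF assms])
qed

end
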